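(* Let $$\mathsf K_2(s):=\partial_\alpha^2\mathsf K(\alpha;s)\big|_{\alpha=0}=-\frac12\sum_{n\ge1}(-1)^n\Bigl(\frac{(s)_n}{n!}\Bigr)^{2}\sum_{j=0}^{n-1}\frac1{(s+j)^2}.$$ Then: (i) $\mathsf K_2$ satisfies the inhomogeneous two-term recurrence $$8s^2(s-1)\,\mathsf K_2(s+1)+2s(s-1)^2\,\mathsf K_2(s-1)=4(s-1)\,\mathsf K_0(s+1)-2(2s-1)\,\mathsf K_0(s)+s\,\mathsf K_0(s-1).$$ Equivalently, the quotient $Q=\mathsf K_2/\mathsf K_0$ obeys $$Q(s+1)-Q(s-1)=\mathsf f(s),\qquad \mathsf f(s)=-\frac{2s-1}{2s^2(s-1)^2}-\frac{(2s-1)\,\mathsf r(s)}{4s^2(s-1)},$$ where $\mathsf r(s)=\dfrac{\mathsf K_0(s)}{\mathsf K_0(s+1)}=\dfrac{2\,\Gamma(1+\frac s2)\Gamma(\frac{1-s}2)}{\Gamma(1-\frac s2)\Gamma(\frac{1+s}2)}$. (ii) On each lattice $\{s_0-2k\}_{k\ge0}$, $\mathsf r$ is bounded and $\mathsf f(\sigma)=O(\sigma^{-2})$, so $\sum_{k\ge0}\mathsf f(s-1-2k)$ converges absolutely and, for $s$ on the lattice, $$\mathsf K_2(s)=\mathsf K_0(s)\Bigl[c(s_0)+\sum_{k\ge0}\mathsf f(s-1-2k)\Bigr]$$ with a lattice constant $c(s_0)$.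
   Context: $\mathsf K(\alpha;s)={}_2F_1(s-\frac\alpha2,s+\frac\alpha2;1;-1)$ (principal branch; entire in $(\alpha,s)$), and $\mathsf K_0(s)=\mathsf K(0;s)=\dfrac{\Gamma(1+\frac s2)}{\Gamma(1+s)\Gamma(1-\frac s2)}$. $(s)_n$ is the Pochhammer symbol. Standing assumption: the base points are $s=(1-Z)/2$ with real $Z>1$, so $s<0$ (in particular $s_0<0$), and the degenerate values $2s\in\mathbb Z_{\le0}$ are excluded. Values at shifted arguments such as $s+1$ are those of the analytically continued functions (the series for $\mathsf K_2$ converges for $\operatorname{Re}s<\frac12$). *)

theory Defs
  imports "HOL-Complex_Analysis.Complex_Analysis" "HOL-Library.Landau_Symbols"
begin

(* Principal branch of the Gauss hypergeometric function: the Gauss series, continued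
   analytically along the straight segment from 0 to z.  The segment avoids the cut [1,\<infinity>)
   iff z does; hyp2F1_principal_branch below shows agreement with any holomorphic extension of
   the series to the cut plane. *)
definition hyp2F1 :: "complex \<Rightarrow> complex \<Rightarrow> complex \<Rightarrow> complex \<Rightarrow> complex" where
  "hyp2F1 a b c z = (THE w. \<exists>U g. open U \<and> closed_segment 0 z \<subseteq> U \<and> g holomorphic_on U \<and>
     (\<forall>\<^sub>F u in nhds 0. g u = eval_fps (fps_hypergeo [a, b] [c] 1) u) \<and> g z = w)"

lemma eval_fps_hypergeo_2_1:
  "eval_fps (fps_hypergeo [a, b] [c] 1) (u :: complex) =
     (\<Sum>n. pochhammer a n * pochhammer b n / (pochhammer c n * fact n) * u ^ n)"
  by (simp add: eval_fps_def)

lemma hyp2F1_eqI: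
  assumes U: "open U" "closed_segment 0 z \<subseteq> U" "g holomorphic_on U"
    and g: "\<forall>\<^sub>F u in nhds 0. g u = eval_fps (fps_hypergeo [a, b] [c] 1) u"
  shows "hyp2F1 a b c z = g z"
  unfolding hyp2F1_def
proof (rule the_equality)
  show "\<exists>U h. open U \<and> closed_segment 0 z \<subseteq> U \<and> h holomorphic_on U \<and>
     (\<forall>\<^sub>F u in nhds 0. h u = eval_fps (fps_hypergeo [a, b] [c] 1) u) \<and> h z = g z"
    using assms by blast
next
  fix w
  assume "\<exists>V h. open V \<and> closed_segment 0 z \<subseteq> V \<and> h holomorphic_on V \<and>
     (\<forall>\<^sub>F u in nhds 0. h u = eval_fps (fps_hypergeo [a, b] [c] 1) u) \<and> h z = w"
  then obtain V h where V: "open V" "closed_segment 0 z \<subseteq> V" "h holomorphic_on V"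
    and h: "\<forall>\<^sub>F u in nhds 0. h u = eval_fps (fps_hypergeo [a, b] [c] 1) u" and w: "h z = w"
    by blast
  define C where "C = connected_component_set (U \<inter> V) 0"
  have seg: "closed_segment 0 z \<subseteq> C"
    unfolding C_def by (rule connected_component_maximal) (use U V in auto)
  have C: "open C" "connected C" "C \<subseteq> U" "C \<subseteq> V"
    using U V connected_component_subset[of "U \<inter> V" 0]
    by (auto simp: C_def intro!: open_connected_component)
  have "\<forall>\<^sub>F u in nhds 0. g u = h u"
    using g h by eventually_elim simp
  then obtain S where S: "open S" "0 \<in> S" "\<And>u. u \<in> S \<Longrightarrow> g u = h u"
    by (auto simp: eventually_nhds)
  have "g z = h z"
  proof (rule analytic_continuation_open[of "S \<inter> C" C g h])
    show "S \<inter> C \<noteq> {}" "z \<in> C" using S(2) seg by auto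
    show "g holomorphic_on C" "h holomorphic_on C"
      using U(3) V(3) C holomorphic_on_subset by blast+
  qed (use S C in auto)
  then show "w = g z" using w by simp
qed

lemma hyp2F1_principal_branch:
  assumes "g holomorphic_on - complex_of_real ` {1..}"
    and "\<forall>\<^sub>F u in nhds 0. g u = eval_fps (fps_hypergeo [a, b] [c] 1) u"
    and z: "z \<notin> complex_of_real ` {1..}"
  shows "hyp2F1 a b c z = g z"
proof (rule hyp2F1_eqI)
  have "closed (complex_of_real ` {1..})"
    by (rule closed_injective_linear_image)
       (auto simp: inj_on_def intro: bounded_linear.linear bounded_linear_of_real)
  then show "open (- complex_of_real ` {1..})" by (simp add: open_closed)
  show "closed_segment 0 z \<subseteq> - complex_of_real ` {1..}"
  proof clarsimp
    fix x :: real
    assume "complex_of_real x \<in> closed_segment 0 z" and x: "1 \<le> x"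
    then obtain t where t: "0 \<le> t" "t \<le> 1" "complex_of_real x = of_real t * z"
      by (auto simp: in_segment scaleR_conv_of_real)
    then have "t > 0" using x by (cases "t = 0") auto
    then have "z = complex_of_real (x / t)" "1 \<le> x / t"
      using t x by (simp_all add: field_simps)
    then have "z \<in> complex_of_real ` {1..}" by blast
    then show False using z by blast
  qed
qed (use assms in auto)

definition hypK :: "complex \<Rightarrow> complex \<Rightarrow> complex" where
  "hypK \<alpha> s = hyp2F1 (s - \<alpha> / 2) (s + \<alpha> / 2) 1 (- 1)"

definition hypK0 :: "complex \<Rightarrow> complex" where
  "hypK0 s = hypK 0 s"

definition hypK2 :: "complex \<Rightarrow> complex" where
  "hypK2 s = (deriv ^^ 2) (\<lambda>\<alpha>. hypK \<alpha> s) 0"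

definition hypK2_term :: "complex \<Rightarrow> nat \<Rightarrow> complex" where
  "hypK2_term s n = (-1) ^ n * (pochhammer s n / fact n) ^ 2 * (\<Sum>j<n. 1 / (s + of_nat j) ^ 2)"

definition quotQ :: "complex \<Rightarrow> complex" where
  "quotQ s = hypK2 s / hypK0 s"

definition ratio_r :: "complex \<Rightarrow> complex" where
  "ratio_r s = hypK0 s / hypK0 (s + 1)"

definition inhom_f :: "complex \<Rightarrow> complex" where
  "inhom_f s = - (2 * s - 1) / (2 * s ^ 2 * (s - 1) ^ 2) - (2 * s - 1) * ratio_r s / (4 * s ^ 2 * (s - 1))"

definition lattice_from :: "real \<Rightarrow> complex set" where
  "lattice_from s\<^sub>0 = {complex_of_real s\<^sub>0 - 2 * of_nat k | k :: nat. True}"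

end

theory Submission
  imports Defs
begin

text \<open>
  The function \<open>hypK \<alpha> s\<close> is defined by analytic continuation to the point \<open>- 1\<close>. Pfaff's
  transformation (\<open>pfaff_fps\<close>, \<open>hyp2F1_eq_pfaff_continuation\<close>) realises this continuation
  by the series
  \<open>2 powr (- a) * (\<Sum>n. (a)\<^sub>n (1 - b)\<^sub>n / (n!\<^sup>2 2\<^sup>n))\<close>
  with \<open>a = s - \<alpha> / 2\<close> and \<open>b = s + \<alpha> / 2\<close>, which converges geometrically for all parameters. It shows that
  \<open>hypK\<close> is entire in each variable, and it satisfies a contiguous relation that can be proved
  termwise by telescoping (\<open>pfaff_term_contiguous_sum\<close>):

  \<open>8 (s - 1) (s\<^sup>2 - \<alpha>\<^sup>2 / 4) K(\<alpha>; s + 1) + (2 s - 1) \<alpha>\<^sup>2 K(\<alpha>; s)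
    + 2 s ((s - 1)\<^sup>2 - \<alpha>\<^sup>2 / 4) K(\<alpha>; s - 1) = 0\<close>.

  The coefficients are even in \<open>\<alpha>\<close> and the middle one vanishes at \<open>\<alpha> = 0\<close>. Setting \<open>\<alpha> = 0\<close>
  gives a two-term recurrence for \<open>hypK0\<close>, and differentiating twice at \<open>\<alpha> = 0\<close> gives the inhomogeneous
  recurrence for \<open>hypK2\<close> (\<open>hypK2_recurrence\<close>). Division by \<open>hypK0\<close> turns the latter into a
  difference equation of step \<open>2\<close> for \<open>quotQ\<close> (\<open>quotQ_recurrence\<close>).

  The division requires that \<open>hypK0\<close> does not vanish off the integers, and the closed form of
  \<open>ratio_r\<close> requires the value of \<open>hypK0\<close>. Both come from Kummer's formula, which is proved by a
  Beta integral on a real interval and extended by the identity theorem (\<open>hypK0_rGamma\<close>).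

  For \<open>Re s < 1 / 2\<close>, \<open>s\<close> not a non-positive integer, the Gauss series at \<open>- 1\<close> converges absolutely to
  \<open>hypK \<alpha> s\<close>, uniformly for small \<open>\<alpha>\<close>. Termwise differentiation of its coefficients
  \<open>\<Prod>j<n. ((s + j)\<^sup>2 - \<alpha>\<^sup>2 / 4) / (j + 1)\<^sup>2\<close> yields the series for \<open>hypK2\<close>
  (\<open>hypK2_term_sums\<close>).

  On a lattice that runs to \<open>- \<infinity>\<close> in steps of \<open>2\<close>, the two-term recurrence for \<open>hypK0\<close> bounds \<open>ratio_r\<close>
  without any asymptotics of the Gamma function. Hence \<open>inhom_f\<close> decays quadratically, and
  the difference equation for \<open>quotQ\<close> can be summed to infinity (\<open>hypK2_lattice_expansion\<close>).
\<close>

section \<open>Hypergeometric coefficients\<close>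

definition hyper_coeff :: "complex \<Rightarrow> complex \<Rightarrow> nat \<Rightarrow> complex" where
  "hyper_coeff a b n = pochhammer a n * pochhammer b n / fact n ^ 2"

lemma fps_hypergeo_nth_hyper_coeff:
  "fps_hypergeo [a, b] [1] c $ n = hyper_coeff a b n * c ^ n"
  by (simp add: hyper_coeff_def power2_eq_square flip: pochhammer_fact)

lemma norm_pochhammer_le:
  fixes z :: complex
  assumes "norm z \<le> A"
  shows "norm (pochhammer z n) \<le> pochhammer A n"
proof (induction n)
  case (Suc n)
  have "norm (z + of_nat n) \<le> A + real n"
    using norm_triangle_ineq[of z "of_nat n"] assms by simp
  moreover have "pochhammer A n \<ge> 0"
    using Suc norm_ge_zero order_trans by blast
  ultimately show ?case
    unfolding pochhammer_Suc norm_mult using Suc by (intro mult_mono) auto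
qed simp

text \<open>
  One real majorant serves every series with argument of norm \<open>r < 1\<close>: with \<open>A\<close> and \<open>B\<close> bounding the parameters on
  a compact set, it dominates the terms uniformly there. The ratio of consecutive terms of the majorant tends to
  \<open>r\<close>.
\<close>
lemma summable_hyper_majorant:
  fixes A B r :: real
  assumes "0 < A" "0 < B" "0 \<le> r" "r < 1"
  shows "summable (\<lambda>n. pochhammer A n * pochhammer B n / fact n ^ 2 * r ^ n)"
proof -
  define c where "c = (1 + r) / 2"
  have "c < 1" "r < c" using assms by (auto simp: c_def)
  have "(\<lambda>n. (A + real n) * (B + real n) / (real n + 1) ^ 2 * r) \<longlonglongrightarrow> 1 * r"
    by (intro tendsto_mult tendsto_const) real_asymp
  then have "\<forall>\<^sub>F n in sequentially. (A + real n) * (B + real n) / (real n + 1) ^ 2 * r < c"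
    using \<open>r < c\<close> by (intro order_tendstoD) auto
  then obtain N where N: "\<And>n. n \<ge> N \<Longrightarrow> (A + real n) * (B + real n) / (real n + 1) ^ 2 * r < c"
    by (auto simp: eventually_at_top_linorder)
  show ?thesis
  proof (rule summable_ratio_test[OF \<open>c < 1\<close>, of N])
    fix n assume "n \<ge> N"
    let ?f = "\<lambda>n. pochhammer A n * pochhammer B n / fact n ^ 2 * r ^ n"
    have nonneg: "?f n \<ge> 0" for n
      using assms by (simp add: pochhammer_nonneg)
    have "?f (Suc n) = (A + real n) * (B + real n) / (real n + 1) ^ 2 * r * ?f n"
      unfolding pochhammer_Suc fact_Suc power_Suc power_mult_distrib of_nat_mult of_nat_Suc
      by (simp add: add.commute)
    also have "\<dots> \<le> c * ?f n"
      using N[OF \<open>n \<ge> N\<close>] nonneg by (intro mult_right_mono) auto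
    finally show "norm (?f (Suc n)) \<le> c * norm (?f n)"
      using nonneg by (simp only: real_norm_def abs_of_nonneg)
  qed
qed

lemma norm_hyper_coeff_le:
  assumes "norm a \<le> A" "norm b \<le> B"
  shows "norm (hyper_coeff a b n) \<le> pochhammer A n * pochhammer B n / fact n ^ 2"
proof -
  have "pochhammer A n \<ge> 0" "pochhammer B n \<ge> 0"
    using assms[THEN norm_pochhammer_le, of n] norm_ge_zero order_trans by blast+
  then show ?thesis
    unfolding hyper_coeff_def norm_divide norm_mult
    using assms by (intro frac_le mult_mono norm_pochhammer_le) (auto simp: norm_power)
qed

lemma conv_radius_fps_hypergeo:
  fixes a b :: complex
  shows
  "fps_conv_radius (fps_hypergeo [a, b] [1] 1) \<ge> 1"
  unfolding fps_conv_radius_def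
proof (rule conv_radius_geI_ex')
  fix r :: real assume r: "0 < r" "ereal r < 1"
  have "summable (\<lambda>n. hyper_coeff a b n * of_real r ^ n)"
  proof (rule summable_comparison_test')
    show "summable (\<lambda>n. pochhammer (norm a + 1) n * pochhammer (norm b + 1) n / fact n ^ 2 * r ^ n)"
      using r by (intro summable_hyper_majorant) (auto intro: add_nonneg_pos)
    show "norm (hyper_coeff a b n * of_real r ^ n)
      \<le> pochhammer (norm a + 1) n * pochhammer (norm b + 1) n / fact n ^ 2 * r ^ n" if "n \<ge> 0" for n
      unfolding norm_mult norm_power using r
      by (intro mult_mono norm_hyper_coeff_le)
        (auto intro!: divide_nonneg_nonneg mult_nonneg_nonneg pochhammer_nonneg add_nonneg_pos)
  qed
  then show "summable (\<lambda>n. fps_hypergeo [a, b] [1] 1 $ n * of_real r ^ n)"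
    by (simp only: fps_hypergeo_nth_hyper_coeff power_one mult_1_right)
qed

section \<open>The Pfaff transformation of formal power series\<close>

text \<open>
  Absorbing the factor \<open>B\<close> into each power of \<open>G\<close> before extracting coefficients. In the Pfaff
  transformation every \<open>B * G ^ k\<close> is a shifted binomial series, whereas the coefficients of
  \<open>F oo G\<close> alone have no convenient form.
\<close>
lemma fps_mult_compose_nth:
  fixes B F G :: "'a::comm_ring_1 fps"
  assumes "G $ 0 = 0"
  shows "(B * (F oo G)) $ n = (\<Sum>k=0..n. F $ k * (B * G ^ k) $ n)"
proof -
  have "(F oo G) $ m = (\<Sum>k=0..n. F $ k * (G ^ k $ m))" if "m \<le> n" for m
    unfolding fps_compose_nth
    using that startsby_zero_power_prefix[OF assms]
    by (intro sum.mono_neutral_left) auto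
  then have "(B * (F oo G)) $ n = (\<Sum>i=0..n. \<Sum>k=0..n. F $ k * (B $ i * (G ^ k $ (n - i))))"
    unfolding fps_mult_nth sum_distrib_left by (intro sum.cong) (auto simp: mult_ac sum_distrib_left)
  also have "\<dots> = (\<Sum>k=0..n. F $ k * (B * G ^ k) $ n)"
    by (subst sum.swap) (simp add: fps_mult_nth sum_distrib_left)
  finally show ?thesis .
qed

text \<open>
  Pfaff's transformation as an identity of formal power series in \<open>y = - z\<close>, where
  \<open>z / (z - 1) = y / (1 + y)\<close>. The coefficient of \<open>y ^ n\<close> is, up to the factor
  \<open>(-1) ^ n (a)\<^sub>n / n!\<close>, a terminating hypergeometric sum of unit argument, which the
  Chu--Vandermonde identity evaluates as \<open>(1 - c)\<^sub>n / n!\<close>.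
\<close>
lemma pfaff_fps:
  fixes a c :: complex
  shows "fps_binomial (- a) * (fps_hypergeo [a, c] [1] 1 oo (fps_X * fps_binomial (- 1)))
         = fps_hypergeo [a, 1 - c] [1] (- 1)"
proof (rule fps_ext)
  fix n
  let ?G = "fps_X * fps_binomial (- 1) :: complex fps"
  have power: "fps_binomial (- a) * ?G ^ k = fps_X ^ k * fps_binomial (- a - of_nat k)" for k
    by (simp add: power_mult_distrib fps_binomial_power mult_ac flip: fps_binomial_add_mult)
  have summand: "hyper_coeff a c k * (fps_binomial (- a) * ?G ^ k) $ n
      = (-1) ^ n * pochhammer a n / fact n *
         (pochhammer c k * pochhammer (- of_nat n) k / (of_nat (fact k) * pochhammer 1 k))"
    if k: "k \<le> n" for k
  proof -
    have 1: "(- a - of_nat k) gchoose (n - k)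
        = (-1) ^ (n - k) * pochhammer (a + of_nat k) (n - k) / fact (n - k)"
      by (simp add: gbinomial_pochhammer add.commute)
    have 2: "pochhammer a n = pochhammer a k * pochhammer (a + of_nat k) (n - k)"
      using pochhammer_product[OF k, of a] .
    have 3: "pochhammer (- of_nat n) k = (-1) ^ k * fact n / (fact (n - k) :: complex)"
    proof -
      have "pochhammer (- of_nat n :: complex) k = (-1) ^ k * ((of_nat n gchoose k) * fact k)"
        by (simp add: gbinomial_pochhammer)
      also have "(of_nat n gchoose k) = (of_nat (n choose k) :: complex)"
        by (simp add: binomial_gbinomial)
      also have "\<dots> = fact n / (fact k * fact (n - k))"
        by (rule binomial_fact[OF k])
      finally show ?thesis by simp
    qed
    have 4: "(-1) ^ (n - k) = (-1) ^ n * ((-1) ^ k :: complex)"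
      using k by (simp add: power_diff_conv_inverse)
    have "pochhammer a k * pochhammer c k / (fact k * fact k) * ((- a - of_nat k) gchoose (n - k))
        = (-1) ^ n * pochhammer a n / fact n * (pochhammer c k * pochhammer (- of_nat n) k / (fact k * fact k))"
      unfolding 1 2 3 4 by (simp add: divide_simps)
    then show ?thesis
      using k by (simp add: power fps_X_power_mult_nth hyper_coeff_def power2_eq_square
          flip: pochhammer_fact)
  qed
  have "(fps_binomial (- a) * (fps_hypergeo [a, c] [1] 1 oo ?G)) $ n
      = (\<Sum>k=0..n. hyper_coeff a c k * (fps_binomial (- a) * ?G ^ k) $ n)"
    by (subst fps_mult_compose_nth) (simp_all only: fps_hypergeo_nth_hyper_coeff power_one mult_1_right, simp)
  also have "\<dots> = (-1) ^ n * pochhammer a n / fact n *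
      (\<Sum>k=0..n. pochhammer c k * pochhammer (- of_nat n) k / (of_nat (fact k) * pochhammer 1 k))"
    unfolding sum_distrib_left by (intro sum.cong refl summand) auto
  also have "(\<Sum>k=0..n. pochhammer c k * pochhammer (- of_nat n) k / (of_nat (fact k) * pochhammer 1 k))
      = pochhammer (1 - c) n / pochhammer 1 n"
  proof (rule Vandermonde_pochhammer)
    show "\<forall>i\<in>{0..<n}. (1::complex) \<noteq> - of_nat i"
      by (metis add_eq_0_iff of_nat_1 of_nat_Suc of_nat_eq_0_iff plus_1_eq_Suc nat.distinct(1) add.commute)
  qed
  also have "(-1) ^ n * pochhammer a n / fact n * (pochhammer (1 - c) n / pochhammer 1 n)
      = fps_hypergeo [a, 1 - c] [1] (- 1) $ n"
    unfolding fps_hypergeo_nth_hyper_coeff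
    by (simp add: hyper_coeff_def power2_eq_square flip: pochhammer_fact)
  finally show "(fps_binomial (- a) * (fps_hypergeo [a, c] [1] 1 oo ?G)) $ n
      = fps_hypergeo [a, 1 - c] [1] (- 1) $ n" .
qed

section \<open>Analytic continuation by the Pfaff transformation\<close>

text \<open>
  The right-hand side of Pfaff's transformation
  \<open>\<^sub>2F\<^sub>1(a, b; 1; z) = (1 - z) powr (- a) \<^sub>2F\<^sub>1(a, 1 - b; 1; z / (z - 1))\<close>. Its inner argument stays in
  the unit disc exactly for \<open>Re z < 1 / 2\<close>, a half-plane that contains both \<open>0\<close> and \<open>- 1\<close>.
\<close>
definition pfaff_continuation :: "complex \<Rightarrow> complex \<Rightarrow> complex \<Rightarrow> complex" where
  "pfaff_continuation a b z =
     (1 - z) powr (- a) * eval_fps (fps_hypergeo [a, 1 - b] [1] 1) (z / (z - 1))"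

lemma pfaff_continuation_near_0:
  "\<forall>\<^sub>F z in nhds 0. pfaff_continuation a b z = eval_fps (fps_hypergeo [a, b] [1] 1) z"
proof -
  define F where "F = fps_hypergeo [a, 1 - b] [1] (1::complex)"
  have "fps_conv_radius F > 0"
    using conv_radius_fps_hypergeo[of a "1 - b"]
    unfolding F_def by (rule less_le_trans[rotated]) simp
  then have F: "eval_fps F has_fps_expansion F"
    by (simp add: has_fps_expansion_def)
  have "(\<lambda>y. y * (1 + y) powr (- 1)) has_fps_expansion fps_X * fps_binomial (- 1 :: complex)"
    by (intro fps_expansion_intros)
  from has_fps_expansion_compose[OF F this]
  have "(eval_fps F \<circ> (\<lambda>y. y * (1 + y) powr (- 1))) has_fps_expansion
      (F oo (fps_X * fps_binomial (- 1)))" by simp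
  from has_fps_expansion_mult[OF has_fps_expansion_binomial_complex[of "- a"] this]
  have "(\<lambda>y. (1 + y) powr (- a) * eval_fps F (y * (1 + y) powr (- 1))) has_fps_expansion
      fps_hypergeo [a, b] [1] (- 1)"
    using pfaff_fps[of a "1 - b"] by (simp add: F_def o_def)
  then have "\<forall>\<^sub>F y in nhds 0. eval_fps (fps_hypergeo [a, b] [1] (- 1)) y
      = (1 + y) powr (- a) * eval_fps F (y * (1 + y) powr (- 1))"
    by (simp only: has_fps_expansion_def)
  moreover have "filterlim uminus (nhds (0::complex)) (nhds 0)"
    using tendsto_minus[OF filterlim_ident[of "nhds (0::complex)"]] by simp
  ultimately have "\<forall>\<^sub>F z in nhds 0. eval_fps (fps_hypergeo [a, b] [1] (- 1)) (- z)
      = (1 + - z) powr (- a) * eval_fps F (- z * (1 + - z) powr (- 1))"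
    by (rule eventually_compose_filterlim)
  then show ?thesis
  proof eventually_elim
    case (elim z)
    have "fps_hypergeo [a, b] [1] (- 1) $ n * (- z) ^ n = fps_hypergeo [a, b] [1] 1 $ n * z ^ n" for n
      by (simp only: fps_hypergeo_nth_hyper_coeff mult.assoc flip: power_mult_distrib) simp
    then have "eval_fps (fps_hypergeo [a, b] [1] (- 1)) (- z) = eval_fps (fps_hypergeo [a, b] [1] 1) z"
      by (simp only: eval_fps_def)
    moreover have "- z * (1 - z) powr (- 1) = z / (z - 1)"
    proof (cases "z = 1")
      case False
      then show ?thesis by (simp add: powr_minus field_simps)
    qed simp
    ultimately show ?case
      using elim by (simp add: pfaff_continuation_def F_def)
  qed
qed

lemma half_plane_imp_norm_less:
  assumes "Re z < 1 / 2"
  shows "norm (z / (z - 1)) < 1"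
proof -
  have "norm z ^ 2 < norm (z - 1) ^ 2"
    using assms unfolding cmod_power2 by (simp add: power2_eq_square algebra_simps)
  then have "norm z < norm (z - 1)"
    by (rule power_less_imp_less_base) simp
  then show ?thesis
    using norm_ge_zero[of z] by (simp add: norm_divide divide_simps del: norm_ge_zero)
qed

lemma holomorphic_pfaff_continuation:
  "pfaff_continuation a b holomorphic_on {z. Re z < 1 / 2}"
proof -
  have "1 - z \<notin> \<real>\<^sub>\<le>\<^sub>0" "z - 1 \<noteq> 0" if "Re z < 1 / 2" for z
    using that by (auto simp: complex_nonpos_Reals_iff)
  moreover have "z / (z - 1) \<in> eball 0 (fps_conv_radius (fps_hypergeo [a, 1 - b] [1] 1))"
    if "Re z < 1 / 2" for z
    using half_plane_imp_norm_less[OF that] conv_radius_fps_hypergeo[of a "1 - b"]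
    by (auto simp: in_eball_iff intro: less_le_trans[of _ "ereal 1"] simp flip: one_ereal_def)
  ultimately show ?thesis
    unfolding pfaff_continuation_def[abs_def]
    by (intro holomorphic_intros holomorphic_on_compose_gen[of "\<lambda>z. z / (z - 1)" _ "eval_fps _", unfolded o_def,
          where t = "eball 0 (fps_conv_radius (fps_hypergeo [a, 1 - b] [1] 1))"]) auto
qed

lemma hyp2F1_eq_pfaff_continuation:
  assumes "Re z < 1 / 2"
  shows "hyp2F1 a b 1 z = pfaff_continuation a b z"
proof (rule hyp2F1_eqI)
  show "open {z. Re z < 1 / 2}" by (rule open_halfspace_Re_lt)
  show "closed_segment 0 z \<subseteq> {z. Re z < 1 / 2}"
    using assms by (intro closed_segment_subset convex_halfspace_Re_lt) auto
qed (fact holomorphic_pfaff_continuation pfaff_continuation_near_0)+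

section \<open>An everywhere convergent series for \<open>\<^sub>2F\<^sub>1(a, b; 1; -1)\<close>\<close>

definition pfaff_term :: "complex \<Rightarrow> complex \<Rightarrow> nat \<Rightarrow> complex" where
  "pfaff_term a b n = hyper_coeff a (1 - b) n / 2 ^ n"

definition pfaffK :: "complex \<Rightarrow> complex \<Rightarrow> complex" where
  "pfaffK a b = 2 powr (- a) * (\<Sum>n. pfaff_term a b n)"

text \<open>
  At \<open>z = - 1\<close> the inner argument of the Pfaff transformation is \<open>1 / 2\<close>, so the series converges
  geometrically for all parameters. This is what makes values at arbitrary \<open>s\<close> accessible.
\<close>
lemma hypK_eq_pfaffK: "hypK \<alpha> s = pfaffK (s - \<alpha> / 2) (s + \<alpha> / 2)"
proof -
  have "eval_fps (fps_hypergeo [a, 1 - b] [1] 1) (1 / 2) = (\<Sum>n. pfaff_term a b n)" for a b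
    unfolding eval_fps_def fps_hypergeo_nth_hyper_coeff pfaff_term_def
    by (simp add: power_divide)
  then show ?thesis
    by (simp add: hypK_def hyp2F1_eq_pfaff_continuation pfaff_continuation_def pfaffK_def)
qed

lemma norm_pfaff_term_le:
  assumes "norm a \<le> A" "norm (1 - b) \<le> B"
  shows "norm (pfaff_term a b n) \<le> pochhammer A n * pochhammer B n / fact n ^ 2 * (1 / 2) ^ n"
  using norm_hyper_coeff_le[OF assms, of n]
  by (simp add: pfaff_term_def norm_divide norm_power power_one_over divide_right_mono field_simps)

lemma summable_pfaff_term: "summable (pfaff_term a b)"
proof (rule summable_comparison_test')
  show "summable (\<lambda>n. pochhammer (norm a + 1) n * pochhammer (norm (1 - b) + 1) n / fact n ^ 2 * (1 / 2) ^ n)"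
    by (intro summable_hyper_majorant) (auto intro: add_nonneg_pos)
qed (intro norm_pfaff_term_le, auto)

text \<open>
  Stated for a holomorphic path of parameters, so that it yields both holomorphy in \<open>\<alpha>\<close> (needed to
  differentiate twice) and holomorphy in \<open>s\<close> (needed for the identity theorem).
\<close>
lemma holomorphic_pfaffK:
  assumes f: "f holomorphic_on S" and g: "g holomorphic_on S" and S: "open S"
  shows "(\<lambda>x. pfaffK (f x) (g x)) holomorphic_on S"
proof -
  have "(\<lambda>x. \<Sum>n. pfaff_term (f x) (g x) n) holomorphic_on S"
  proof (rule holomorphic_uniform_sequence[OF S])
    show "(\<lambda>x. \<Sum>n<N. pfaff_term (f x) (g x) n) holomorphic_on S" for N
      unfolding pfaff_term_def hyper_coeff_def
      by (intro holomorphic_intros f g) auto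
    fix x assume "x \<in> S"
    then obtain d where d: "d > 0" "cball x d \<subseteq> S"
      using S open_contains_cball by blast
    have "bounded (f ` cball x d)" "bounded ((\<lambda>x. 1 - g x) ` cball x d)"
      using d f g holomorphic_on_imp_continuous_on holomorphic_on_subset
      by (auto intro!: compact_imp_bounded compact_continuous_image continuous_intros)
    then obtain A B where AB: "A > 0" "B > 0"
      "\<And>y. y \<in> cball x d \<Longrightarrow> norm (f y) \<le> A" "\<And>y. y \<in> cball x d \<Longrightarrow> norm (1 - g y) \<le> B"
      unfolding bounded_pos by (metis imageI)
    have "uniform_limit (cball x d) (\<lambda>N x. \<Sum>n<N. pfaff_term (f x) (g x) n)
        (\<lambda>x. \<Sum>n. pfaff_term (f x) (g x) n) sequentially"
    proof (rule Weierstrass_m_test)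
      show "norm (pfaff_term (f y) (g y) n) \<le> pochhammer A n * pochhammer B n / fact n ^ 2 * (1 / 2) ^ n"
        if "y \<in> cball x d" for n y
        using that AB by (intro norm_pfaff_term_le) auto
      show "summable (\<lambda>n. pochhammer A n * pochhammer B n / fact n ^ 2 * (1 / 2) ^ n)"
        using AB by (intro summable_hyper_majorant) auto
    qed
    with d show "\<exists>d>0. cball x d \<subseteq> S \<and> uniform_limit (cball x d)
        (\<lambda>N x. \<Sum>n<N. pfaff_term (f x) (g x) n) (\<lambda>x. \<Sum>n. pfaff_term (f x) (g x) n) sequentially"
      by blast
  qed
  then show ?thesis
    unfolding pfaffK_def by (intro holomorphic_intros f) auto
qed

section \<open>The contiguous relation\<close>

text \<open>
  A telescoping certificate in the manner of Zeilberger's algorithm. All three terms at index \<open>n \<ge> 1\<close>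
  are polynomial multiples of \<open>(a)\<^sub>n\<^sub>-\<^sub>1 (1 - b)\<^sub>n\<^sub>-\<^sub>1 / (n!\<^sup>2 2\<^sup>n)\<close>, and their combination is the
  difference of consecutive multiples of \<open>pfaff_term a b\<close> by a factor not depending on \<open>n\<close>. That factor is
  forced by \<open>n = 0\<close>. The coefficients \<open>a * b\<close> and \<open>(a - 1) * (b - 1)\<close> supply exactly the factors that
  raise or lower the Pochhammer symbols.
\<close>
lemma pfaff_term_contiguous_sum:
  "(\<Sum>n\<le>N. 2 * (a + b - 2) * a * b * pfaff_term (a + 1) (b + 1) n
          + (a + b - 1) * (b - a) ^ 2 * pfaff_term a b n
          + 2 * (a + b) * (a - 1) * (b - 1) * pfaff_term (a - 1) (b - 1) n)
   = (2 * (a + b - 2) * a * b + (a + b - 1) * (b - a) ^ 2 + 2 * (a + b) * (a - 1) * (b - 1))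
       * pfaff_term a b N"
proof (induction N)
  case 0
  show ?case by (simp add: pfaff_term_def hyper_coeff_def)
next
  case (Suc N)
  define p q where "p = pochhammer a N" and "q = pochhammer (1 - b) N"
  define m d where "m = (of_nat N :: complex)" and "d = fact N ^ 2 * (2::complex) ^ N"
  have nz: "d \<noteq> 0" "m + 1 \<noteq> 0"
    unfolding d_def m_def using of_nat_Suc[of N] of_nat_neq_0[of N, where ?'a = complex]
    by (simp_all add: add.commute)
  have fact: "fact (Suc N) ^ 2 * (2::complex) ^ Suc N = 2 * (m + 1) ^ 2 * d"
    by (simp add: d_def m_def power2_eq_square algebra_simps)
  have P: "pfaff_term x y n = pochhammer x n * pochhammer (1 - y) n / (fact n ^ 2 * 2 ^ n)" for x y n
    by (simp add: pfaff_term_def hyper_coeff_def)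
  have up: "a * b * (pochhammer (a + 1) (Suc N) * pochhammer (1 - (b + 1)) (Suc N))
      = - (b ^ 2) * (a + m) * (a + m + 1) * (p * q)"
  proof -
    have "a * pochhammer (a + 1) (Suc N) = p * (a + m) * (a + m + 1)"
      unfolding p_def m_def pochhammer_rec[symmetric] by (simp add: pochhammer_Suc add_ac)
    moreover have "pochhammer (1 - (b + 1)) (Suc N) = - b * q"
      unfolding q_def pochhammer_rec by simp
    ultimately show ?thesis by (simp add: power2_eq_square)
  qed
  have down: "(a - 1) * (b - 1) * (pochhammer (a - 1) (Suc N) * pochhammer (1 - (b - 1)) (Suc N))
      = - ((a - 1) ^ 2) * (1 - b + m) * (1 - b + m + 1) * (p * q)"
  proof -
    have "(1 - b) * pochhammer (1 - b + 1) (Suc N) = q * (1 - b + m) * (1 - b + m + 1)"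
      unfolding q_def m_def pochhammer_rec[symmetric] by (simp add: pochhammer_Suc add_ac)
    moreover have "pochhammer (a - 1) (Suc N) = (a - 1) * p"
      unfolding p_def pochhammer_rec by simp
    moreover have "1 - (b - 1) = 1 - b + 1" by simp
    ultimately show ?thesis by algebra
  qed
  have mid: "pochhammer a (Suc N) * pochhammer (1 - b) (Suc N) = (a + m) * (1 - b + m) * (p * q)"
    by (simp add: pochhammer_Suc p_def q_def m_def)
  \<comment> \<open>the constant factor of the telescoping, so that the combination of terms is \<open>R * (T\<^sub>N\<^sub>+\<^sub>1 - T\<^sub>N)\<close> for \<open>T = pfaff_term a b\<close>\<close>
  define R where "R = 2 * (a + b - 2) * a * b + (a + b - 1) * (b - a) ^ 2 + 2 * (a + b) * (a - 1) * (b - 1)"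
  have "2 * (a + b - 2) * (- (b ^ 2) * (a + m) * (a + m + 1))
          + (a + b - 1) * (b - a) ^ 2 * ((a + m) * (1 - b + m))
          + 2 * (a + b) * (- ((a - 1) ^ 2) * (1 - b + m) * (1 - b + m + 1))
      = R * ((a + m) * (1 - b + m)) - R * (2 * (m + 1) ^ 2)"
    unfolding R_def by algebra
  then have key: "2 * (a + b - 2) * (- (b ^ 2) * (a + m) * (a + m + 1) * (p * q))
          + (a + b - 1) * (b - a) ^ 2 * ((a + m) * (1 - b + m) * (p * q))
          + 2 * (a + b) * (- ((a - 1) ^ 2) * (1 - b + m) * (1 - b + m + 1) * (p * q))
      = R * ((a + m) * (1 - b + m) * (p * q)) - R * (p * q) * (2 * (m + 1) ^ 2)"
    by algebra
  have "2 * (a + b - 2) * a * b * pfaff_term (a + 1) (b + 1) (Suc N)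
          + (a + b - 1) * (b - a) ^ 2 * pfaff_term a b (Suc N)
          + 2 * (a + b) * (a - 1) * (b - 1) * pfaff_term (a - 1) (b - 1) (Suc N)
      = (2 * (a + b - 2) * (a * b * (pochhammer (a + 1) (Suc N) * pochhammer (1 - (b + 1)) (Suc N)))
          + (a + b - 1) * (b - a) ^ 2 * (pochhammer a (Suc N) * pochhammer (1 - b) (Suc N))
          + 2 * (a + b) * ((a - 1) * (b - 1) * (pochhammer (a - 1) (Suc N) * pochhammer (1 - (b - 1)) (Suc N))))
         / (2 * (m + 1) ^ 2 * d)"
    unfolding P fact by (simp add: add_divide_distrib mult.assoc)
  also have "\<dots> = (R * ((a + m) * (1 - b + m) * (p * q)) - R * (p * q) * (2 * (m + 1) ^ 2)) / (2 * (m + 1) ^ 2 * d)"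
    unfolding up mid down by (simp only: key)
  also have "\<dots> = R * pfaff_term a b (Suc N) - R * pfaff_term a b N"
    unfolding P fact mid using nz
    by (simp add: diff_divide_distrib p_def q_def d_def)
  finally show ?case
    unfolding sum.atMost_Suc Suc.IH R_def[symmetric] by algebra
qed

text \<open>
  The right-hand side of the telescoped sum tends to \<open>0\<close>. The unequal outer coefficients come
  from the prefactor \<open>2 powr (- a)\<close>, which halves or doubles when \<open>a\<close> is shifted by one.
\<close>
lemma pfaffK_contiguous:
  "4 * (a + b - 2) * a * b * pfaffK (a + 1) (b + 1) + (a + b - 1) * (b - a) ^ 2 * pfaffK a b
     + (a + b) * (a - 1) * (b - 1) * pfaffK (a - 1) (b - 1) = 0"
proof -
  define S where "S = (\<lambda>a b. \<Sum>n. pfaff_term a b n)"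
  have S: "(\<lambda>N. \<Sum>n\<le>N. pfaff_term a b n) \<longlonglongrightarrow> S a b" for a b
    unfolding S_def by (rule summable_LIMSEQ'[OF summable_pfaff_term])
  have "(\<lambda>N. 2 * (a + b - 2) * a * b * (\<Sum>n\<le>N. pfaff_term (a + 1) (b + 1) n)
          + (a + b - 1) * (b - a) ^ 2 * (\<Sum>n\<le>N. pfaff_term a b n)
          + 2 * (a + b) * (a - 1) * (b - 1) * (\<Sum>n\<le>N. pfaff_term (a - 1) (b - 1) n))
      \<longlonglongrightarrow> 2 * (a + b - 2) * a * b * S (a + 1) (b + 1)
          + (a + b - 1) * (b - a) ^ 2 * S a b + 2 * (a + b) * (a - 1) * (b - 1) * S (a - 1) (b - 1)"
    by (intro tendsto_intros S)
  moreover have "(\<lambda>N. 2 * (a + b - 2) * a * b * (\<Sum>n\<le>N. pfaff_term (a + 1) (b + 1) n)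
          + (a + b - 1) * (b - a) ^ 2 * (\<Sum>n\<le>N. pfaff_term a b n)
          + 2 * (a + b) * (a - 1) * (b - 1) * (\<Sum>n\<le>N. pfaff_term (a - 1) (b - 1) n))
      \<longlonglongrightarrow> (2 * (a + b - 2) * a * b + (a + b - 1) * (b - a) ^ 2 + 2 * (a + b) * (a - 1) * (b - 1)) * 0"
    unfolding sum_distrib_left sum.distrib[symmetric] pfaff_term_contiguous_sum
    by (intro tendsto_mult tendsto_const summable_LIMSEQ_zero summable_pfaff_term)
  ultimately have "2 * (a + b - 2) * a * b * S (a + 1) (b + 1)
          + (a + b - 1) * (b - a) ^ 2 * S a b + 2 * (a + b) * (a - 1) * (b - 1) * S (a - 1) (b - 1) = 0"
    using LIMSEQ_unique by fastforce
  moreover have "2 * pfaffK (a + 1) (b + 1) = 2 powr (- a) * S (a + 1) (b + 1)"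
    by (simp add: pfaffK_def S_def powr_diff)
  moreover have "pfaffK (a - 1) (b - 1) = 2 * (2 powr (- a) * S (a - 1) (b - 1))"
    by (simp add: pfaffK_def S_def powr_diff powr_minus field_simps)
  moreover have "pfaffK a b = 2 powr (- a) * S a b"
    by (simp add: pfaffK_def S_def)
  ultimately show ?thesis by algebra
qed

section \<open>The recurrence for \<open>hypK2\<close>\<close>

text \<open>
  The quadratic factor has no linear part, so the mixed term of the product rule vanishes at \<open>0\<close>. All
  coefficients below depend on \<open>\<alpha>\<close> only through \<open>\<alpha> ^ 2\<close>.
\<close>
lemma higher_deriv_2_even_quadratic_mult:
  assumes g: "g holomorphic_on UNIV"
  shows "(deriv ^^ 2) (\<lambda>x. (c + d * x ^ 2) * g x) 0 = c * (deriv ^^ 2) g 0 + 2 * d * g 0"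
proof -
  have g': "deriv g holomorphic_on UNIV"
    using g by (rule holomorphic_deriv) auto
  have D: "(h has_field_derivative deriv h x) (at x)" if "h holomorphic_on UNIV" for h and x :: complex
    using that by (auto intro: holomorphic_derivI)
  have "((\<lambda>x. (c + d * x ^ 2) * g x) has_field_derivative
      2 * d * x * g x + (c + d * x ^ 2) * deriv g x) (at x)" for x
    by (auto intro!: derivative_eq_intros D g simp: algebra_simps)
  then have "deriv (\<lambda>x. (c + d * x ^ 2) * g x) = (\<lambda>x. 2 * d * x * g x + (c + d * x ^ 2) * deriv g x)"
    by (intro ext DERIV_imp_deriv)
  moreover have "((\<lambda>x. 2 * d * x * g x + (c + d * x ^ 2) * deriv g x) has_field_derivative
      2 * d * g 0 + c * deriv (deriv g) 0) (at 0)"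
    by (auto intro!: derivative_eq_intros D g g')
  ultimately show ?thesis
    by (simp add: numeral_2_eq_2 DERIV_imp_deriv)
qed

lemma holomorphic_hypK [holomorphic_intros]:
  assumes "f holomorphic_on S" "g holomorphic_on S" "open S"
  shows "(\<lambda>x. hypK (f x) (g x)) holomorphic_on S"
  unfolding hypK_eq_pfaffK using assms by (intro holomorphic_pfaffK holomorphic_intros) auto

text \<open>
  With \<open>a = s - \<alpha> / 2\<close> and \<open>b = s + \<alpha> / 2\<close>, the middle coefficient \<open>(a + b - 1) * (b - a) ^ 2\<close> is divisible
  by \<open>\<alpha> ^ 2\<close>. Hence the three-term relation degenerates to a two-term one at \<open>\<alpha> = 0\<close>, and the middle term
  enters the second derivative only through \<open>hypK0 s\<close>.
\<close>
lemma hypK_contiguous: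
  "8 * (s - 1) * (s ^ 2 - \<alpha> ^ 2 / 4) * hypK \<alpha> (s + 1) + (2 * s - 1) * \<alpha> ^ 2 * hypK \<alpha> s
     + 2 * s * ((s - 1) ^ 2 - \<alpha> ^ 2 / 4) * hypK \<alpha> (s - 1) = 0"
proof -
  define a b where "a = s - \<alpha> / 2" and "b = s + \<alpha> / 2"
  have "hypK \<alpha> (s + 1) = pfaffK (a + 1) (b + 1)" "hypK \<alpha> s = pfaffK a b"
    "hypK \<alpha> (s - 1) = pfaffK (a - 1) (b - 1)"
    by (simp_all add: hypK_eq_pfaffK a_def b_def algebra_simps)
  moreover have "4 * (a + b - 2) * a * b = 8 * (s - 1) * (s ^ 2 - \<alpha> ^ 2 / 4)"
    "(a + b - 1) * (b - a) ^ 2 = (2 * s - 1) * \<alpha> ^ 2"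
    "(a + b) * (a - 1) * (b - 1) = 2 * s * ((s - 1) ^ 2 - \<alpha> ^ 2 / 4)"
    by (simp_all add: a_def b_def field_simps power2_eq_square)
  ultimately show ?thesis
    using pfaffK_contiguous[of a b] by simp
qed

lemma hypK0_recurrence: "s * (s - 1) * (4 * s * hypK0 (s + 1) + (s - 1) * hypK0 (s - 1)) = 0"
proof -
  have "2 * (s * (s - 1) * (4 * s * hypK0 (s + 1) + (s - 1) * hypK0 (s - 1))) = 0"
    using hypK_contiguous[of s 0] by (simp add: hypK0_def power2_eq_square algebra_simps)
  then show ?thesis by simp
qed

text \<open>
  The second \<open>\<alpha>\<close>-derivative at \<open>0\<close> of the contiguous relation: \<open>F\<close>, \<open>G\<close>, \<open>H\<close> are its three terms,
  with coefficients sorted by powers of \<open>\<alpha>\<close>.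
\<close>
lemma hypK2_recurrence:
  "8 * s ^ 2 * (s - 1) * hypK2 (s + 1) + 2 * s * (s - 1) ^ 2 * hypK2 (s - 1)
     = 4 * (s - 1) * hypK0 (s + 1) - 2 * (2 * s - 1) * hypK0 s + s * hypK0 (s - 1)"
proof -
  have hol: "(\<lambda>\<alpha>. hypK \<alpha> t) holomorphic_on UNIV" for t
    by (intro holomorphic_intros) auto
  define F where "F = (\<lambda>\<alpha>. (8 * (s - 1) * s ^ 2 + (- 2 * (s - 1)) * \<alpha> ^ 2) * hypK \<alpha> (s + 1))"
  define G where "G = (\<lambda>\<alpha>. (0 + (2 * s - 1) * \<alpha> ^ 2) * hypK \<alpha> s)"
  define H where "H = (\<lambda>\<alpha>. (2 * s * (s - 1) ^ 2 + (- s / 2) * \<alpha> ^ 2) * hypK \<alpha> (s - 1))"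
  have FGH: "F holomorphic_on UNIV" "G holomorphic_on UNIV" "H holomorphic_on UNIV"
    unfolding F_def G_def H_def by (intro holomorphic_intros; simp)+
  have "F \<alpha> + G \<alpha> + H \<alpha> = 0" for \<alpha>
    using hypK_contiguous[of s \<alpha>] by (simp add: F_def G_def H_def algebra_simps)
  then have "(deriv ^^ 2) (\<lambda>\<alpha>. F \<alpha> + G \<alpha> + H \<alpha>) 0 = 0"
    by (simp add: numeral_2_eq_2)
  moreover have "(deriv ^^ 2) (\<lambda>\<alpha>. F \<alpha> + G \<alpha> + H \<alpha>) 0
      = (deriv ^^ 2) F 0 + (deriv ^^ 2) G 0 + (deriv ^^ 2) H 0"
    using FGH by (simp add: higher_deriv_add[of _ UNIV] holomorphic_on_add)
  ultimately show ?thesis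
    unfolding F_def G_def H_def higher_deriv_2_even_quadratic_mult[OF hol]
    by (simp add: hypK0_def[symmetric] hypK2_def[symmetric] algebra_simps)
qed

section \<open>The series for \<open>hypK2\<close>\<close>

text \<open>
  Gauss's limit \<open>rGamma_series s \<longlonglongrightarrow> rGamma s\<close> says that \<open>(s)\<^sub>n / n!\<close> is at most of order \<open>n powr (Re s - 1)\<close>, also
  at the poles of \<open>Gamma\<close>. The number \<open>rGamma_series s n\<close> contains the Pochhammer symbol of order
  \<open>n + 1\<close> but the power \<open>n powr s\<close>. Replacing the latter by \<open>(n + 1) powr s\<close> costs the factor
  \<open>max 1 (2 powr (- Re s))\<close>.
\<close>
lemma norm_pochhammer_over_fact_bound:
  "\<exists>C. \<forall>n. norm (pochhammer (s::complex) (Suc n) / fact (Suc n)) \<le> C * real (Suc n) powr (Re s - 1)"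
proof -
  have "bounded (range (rGamma_series s))"
    using rGamma_series_LIMSEQ[of s] convergent_imp_bounded by (auto simp: convergent_def)
  then obtain C where C: "C > 0" "\<And>n. norm (rGamma_series s n) \<le> C"
    unfolding bounded_pos by auto
  \<comment> \<open>the term \<open>norm s\<close> takes care of \<open>n = 0\<close>, where the factor \<open>n powr s\<close> of \<open>rGamma_series\<close> degenerates\<close>
  define C' where "C' = max (norm s) (C * max 1 (2 powr (- Re s)))"
  have "norm (pochhammer s (Suc n) / fact (Suc n)) \<le> C' * real (Suc n) powr (Re s - 1)" for n
  proof (cases "n = 0")
    case True
    then show ?thesis by (simp add: C'_def)
  next
    case False
    have "norm (pochhammer s (Suc n) / fact (Suc n))
        = norm (rGamma_series s n) * real n powr Re s / real (Suc n)"
      using False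
      by (simp add: rGamma_series_def norm_divide norm_mult norm_exp_eq_Re powr_def mult.commute del: of_nat_Suc)
    also have "\<dots> \<le> C * real n powr Re s / real (Suc n)"
      using C by (intro divide_right_mono mult_right_mono) auto
    also have "real n powr Re s \<le> max 1 (2 powr (- Re s)) * real (Suc n) powr Re s"
    proof (cases "Re s \<ge> 0")
      case True
      then have "real n powr Re s \<le> 1 * real (Suc n) powr Re s"
        by (simp add: powr_mono2)
      also have "\<dots> \<le> max 1 (2 powr (- Re s)) * real (Suc n) powr Re s"
        by (intro mult_right_mono) auto
      finally show ?thesis .
    next
      case neg: False
      have "real n powr Re s \<le> (real (Suc n) / 2) powr Re s"
        using neg False by (intro powr_mono2') auto
      also have "\<dots> = 2 powr (- Re s) * real (Suc n) powr Re s"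
        by (subst powr_divide) (auto simp: powr_minus field_simps)
      also have "\<dots> \<le> max 1 (2 powr (- Re s)) * real (Suc n) powr Re s"
        by (intro mult_right_mono) auto
      finally show ?thesis .
    qed
    also have "C * (max 1 (2 powr (- Re s)) * real (Suc n) powr Re s) / real (Suc n)
        = C * max 1 (2 powr (- Re s)) * real (Suc n) powr (Re s - 1)"
      by (simp add: powr_diff)
    also have "\<dots> \<le> C' * real (Suc n) powr (Re s - 1)"
      unfolding C'_def by (intro mult_right_mono) auto
    finally show ?thesis using C(1) by (simp add: mult_left_mono divide_right_mono)
  qed
  then show ?thesis by blast
qed

text \<open>
  The terms are at most of order \<open>n powr (2 * Re s - 2)\<close>; this is where the half-plane \<open>Re s < 1 / 2\<close> comes from.
\<close>
lemma summable_norm_hyper_coeff_diag: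
  assumes "Re s < 1 / 2"
  shows "summable (\<lambda>n. norm (hyper_coeff s s n))"
proof -
  obtain C where C: "\<And>n. norm (pochhammer s (Suc n) / fact (Suc n)) \<le> C * real (Suc n) powr (Re s - 1)"
    using norm_pochhammer_over_fact_bound by blast
  have "summable (\<lambda>n. norm (hyper_coeff s s (Suc n)))"
  proof (rule summable_comparison_test')
    have "summable (\<lambda>n. real (Suc n) powr (2 * Re s - 2))"
      unfolding summable_Suc_iff[of "\<lambda>n. real n powr (2 * Re s - 2)"]
      using assms by (simp add: summable_real_powr_iff)
    then show "summable (\<lambda>n. C ^ 2 * real (Suc n) powr (2 * Re s - 2))"
      by (rule summable_mult)
    show "norm (norm (hyper_coeff s s (Suc n))) \<le> C ^ 2 * real (Suc n) powr (2 * Re s - 2)" if "n \<ge> 0" for n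
    proof -
      have "norm (hyper_coeff s s (Suc n)) = norm (pochhammer s (Suc n) / fact (Suc n)) ^ 2"
        unfolding hyper_coeff_def norm_power[symmetric] power_divide by (simp add: power2_eq_square)
      also have "\<dots> \<le> (C * real (Suc n) powr (Re s - 1)) ^ 2"
        by (intro power_mono C) auto
      also have "\<dots> = C ^ 2 * real (Suc n) powr (2 * Re s - 2)"
        by (simp add: power_mult_distrib power2_eq_square flip: powr_add)
      finally show ?thesis by simp
    qed
  qed
  then show ?thesis
    using summable_Suc_iff[of "\<lambda>n. norm (hyper_coeff s s n)"] by blast
qed

text \<open>
  An Abel-type statement. The point \<open>- 1\<close> lies on the boundary of the disc of convergence, where
  \<open>hyp2F1\<close> is defined by continuation. Absolute convergence makes the Gauss series continuous on the
  closed disc, and it agrees with the Pfaff continuation on the open disc near \<open>- 1\<close>. Both therefore have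
  the same limit along the points \<open>- k / (k + 1)\<close>.
\<close>
lemma hyp2F1_minus_one_eq_series:
  assumes summable: "summable (\<lambda>n. norm (hyper_coeff a b n))"
  shows "hyp2F1 a b 1 (- 1) = (\<Sum>n. (-1) ^ n * hyper_coeff a b n)"
proof -
  define P where "P = (\<lambda>z. \<Sum>n. hyper_coeff a b n * z ^ n)"
  have eval: "eval_fps (fps_hypergeo [a, b] [1] 1) = P"
    unfolding eval_fps_def fps_hypergeo_nth_hyper_coeff P_def by simp
  have "uniform_limit (cball 0 1) (\<lambda>N z. \<Sum>n<N. hyper_coeff a b n * z ^ n) P sequentially"
    unfolding P_def
  proof (rule Weierstrass_m_test[OF _ summable])
    fix n and z :: complex assume "z \<in> cball 0 1"
    then show "norm (hyper_coeff a b n * z ^ n) \<le> norm (hyper_coeff a b n)"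
      by (simp add: norm_mult norm_power mult_left_le power_le_one)
  qed
  then have cont: "continuous_on (cball 0 1) P"
    by (rule uniform_limit_theorem[rotated]) (auto intro!: always_eventually continuous_intros)
  have inside: "pfaff_continuation a b z = P z" if "norm z < 1" "Re z < 1 / 2" for z
  proof -
    have "hyp2F1 a b 1 z = P z"
    proof (rule hyp2F1_eqI[of "ball 0 1"])
      show "closed_segment 0 z \<subseteq> ball 0 1"
        using that by (intro closed_segment_subset) auto
      have "ball 0 1 \<subseteq> eball 0 (fps_conv_radius (fps_hypergeo [a, b] [1] (1::complex)))"
        using conv_radius_fps_hypergeo[of a b]
        by (force simp: in_eball_iff intro: less_le_trans[of _ 1])
      then show "P holomorphic_on ball 0 1"
        unfolding eval[symmetric] by (rule holomorphic_on_eval_fps)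
    qed (auto simp: eval)
    then show ?thesis
      using hyp2F1_eq_pfaff_continuation[OF that(2)] by simp
  qed
  define z where "z = (\<lambda>k. - (of_nat k / of_nat (Suc k) :: complex))"
  have z: "z \<longlonglongrightarrow> - 1"
    unfolding z_def by (intro tendsto_minus LIMSEQ_n_over_Suc_n)
  have norm_z: "norm (z k) < 1" for k
    unfolding z_def by (simp add: norm_divide del: of_nat_Suc)
  have z_re: "Re (z k) < 1 / 2" for k
  proof -
    have "z k = of_real (- (real k / real (Suc k)))"
      by (simp add: z_def)
    moreover have "real k / real (Suc k) \<ge> 0"
      by (intro divide_nonneg_nonneg of_nat_0_le_iff)
    ultimately show ?thesis
      by (simp only: Re_complex_of_real)
  qed
  have "(\<lambda>k. P (z k)) \<longlonglongrightarrow> P (- 1)"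
    using norm_z by (intro continuous_on_tendsto_compose[OF cont z]) (auto intro: less_imp_le always_eventually)
  moreover have "(\<lambda>k. pfaff_continuation a b (z k)) \<longlonglongrightarrow> pfaff_continuation a b (- 1)"
    using z_re holomorphic_on_imp_continuous_on[OF holomorphic_pfaff_continuation]
    by (intro continuous_on_tendsto_compose[OF _ z]) auto
  then have "(\<lambda>k. P (z k)) \<longlonglongrightarrow> pfaff_continuation a b (- 1)"
    by (simp only: inside[OF norm_z z_re])
  ultimately have "P (- 1) = pfaff_continuation a b (- 1)"
    by (rule LIMSEQ_unique)
  then show ?thesis
    by (simp add: hyp2F1_eq_pfaff_continuation P_def mult.commute)
qed

lemma hypK_eq_series:
  assumes "summable (\<lambda>n. norm (hyper_coeff (s - \<alpha> / 2) (s + \<alpha> / 2) n))"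
  shows "hypK \<alpha> s = (\<Sum>n. (-1) ^ n * hyper_coeff (s - \<alpha> / 2) (s + \<alpha> / 2) n)"
  unfolding hypK_def by (rule hyp2F1_minus_one_eq_series[OF assms])

text \<open>
  The coefficient of \<open>hypK \<alpha> s\<close> is \<open>\<Prod>j<n. ((s + j)\<^sup>2 - \<alpha>\<^sup>2 / 4) / (j + 1)\<^sup>2\<close>; in recursive form
  it meets \<open>higher_deriv_2_even_quadratic_mult\<close>.
\<close>
lemma hyper_coeff_symmetric_Suc:
  "hyper_coeff (s - \<alpha> / 2) (s + \<alpha> / 2) (Suc n)
    = ((s + of_nat n) ^ 2 / of_nat (Suc n) ^ 2 + (- 1 / (4 * of_nat (Suc n) ^ 2)) * \<alpha> ^ 2)
        * hyper_coeff (s - \<alpha> / 2) (s + \<alpha> / 2) n"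
proof -
  have "hyper_coeff (s - \<alpha> / 2) (s + \<alpha> / 2) (Suc n)
      = (s - \<alpha> / 2 + of_nat n) * (s + \<alpha> / 2 + of_nat n) / of_nat (Suc n) ^ 2
        * hyper_coeff (s - \<alpha> / 2) (s + \<alpha> / 2) n"
    by (simp add: hyper_coeff_def pochhammer_Suc power_mult_distrib del: of_nat_Suc)
  also have "(s - \<alpha> / 2 + of_nat n) * (s + \<alpha> / 2 + of_nat n) = (s + of_nat n) ^ 2 + (- 1 / 4) * \<alpha> ^ 2"
    by (simp add: power2_eq_square algebra_simps)
  finally show ?thesis by (simp add: diff_divide_distrib left_diff_distrib del: of_nat_Suc)
qed

lemma summable_inverse_shifted_square:
  "summable (\<lambda>j. 1 / (4 * norm (s + of_nat j :: complex) ^ 2))"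
proof (rule summable_comparison_test_ev)
  show "summable (\<lambda>j. inverse (real j ^ 2))"
    by (rule inverse_power_summable) auto
  show "\<forall>\<^sub>F j in sequentially. norm (1 / (4 * norm (s + of_nat j) ^ 2)) \<le> inverse (real j ^ 2)"
    using eventually_ge_at_top[of "nat \<lceil>2 * norm s\<rceil>"] eventually_gt_at_top[of 0]
  proof eventually_elim
    case (elim j)
    then have "2 * norm s \<le> real j" by linarith
    moreover have "real j \<le> norm (s + of_nat j) + norm s"
      using norm_triangle_ineq4[of "s + of_nat j" s] by simp
    ultimately have "real j \<le> 2 * norm (s + of_nat j)" by linarith
    then have "real j ^ 2 \<le> (2 * norm (s + of_nat j)) ^ 2"
      by (intro power_mono) auto
    then have "1 / (2 * norm (s + of_nat j)) ^ 2 \<le> 1 / real j ^ 2"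
      using elim by (intro divide_left_mono mult_pos_pos) (auto simp: zero_less_mult_iff)
    then show ?case
      by (simp add: power_mult_distrib inverse_eq_divide)
  qed
qed

text \<open>
  Relative to \<open>\<alpha> = 0\<close>, the coefficients change by the product of the factors
  \<open>1 - \<alpha>\<^sup>2 / (4 * (s + j)\<^sup>2)\<close>. Since \<open>\<Sum>j. 1 / (4 * norm (s + j) ^ 2)\<close> converges, these products are bounded
  uniformly in \<open>n\<close> and in \<open>norm \<alpha> \<le> 1\<close>.
\<close>
lemma hyper_coeff_symmetric_bound:
  assumes "s \<notin> \<int>\<^sub>\<le>\<^sub>0"
  shows "\<exists>C. \<forall>\<alpha> n. norm \<alpha> \<le> 1 \<longrightarrow>
    norm (hyper_coeff (s - \<alpha> / 2) (s + \<alpha> / 2) n) \<le> C * norm (hyper_coeff s s n)"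
proof -
  define e where "e = (\<lambda>j. 1 / (4 * norm (s + of_nat j) ^ 2))"
  have sne: "s + of_nat j \<noteq> 0" for j
    using assms by (metis add_eq_0_iff2 minus_of_nat_in_nonpos_Ints)
  have "norm (hyper_coeff (s - \<alpha> / 2) (s + \<alpha> / 2) n) \<le> exp (\<Sum>j<n. e j) * norm (hyper_coeff s s n)"
    if "norm \<alpha> \<le> 1" for \<alpha> n
  proof (induction n)
    case (Suc n)
    have step: "hyper_coeff (s - \<alpha> / 2) (s + \<alpha> / 2) (Suc n)
        = (1 - \<alpha> ^ 2 / (4 * (s + of_nat n) ^ 2)) * ((s + of_nat n) ^ 2 / of_nat (Suc n) ^ 2)
            * hyper_coeff (s - \<alpha> / 2) (s + \<alpha> / 2) n"
    proof -
      have "w ^ 2 / m ^ 2 + (- 1 / (4 * m ^ 2)) * x = (1 - x / (4 * w ^ 2)) * (w ^ 2 / m ^ 2)"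
        if "w \<noteq> 0" for w m x :: complex
        using that by (simp add: left_diff_distrib diff_divide_distrib)
      from this[OF sne] show ?thesis
        unfolding hyper_coeff_symmetric_Suc by (simp only:)
    qed
    have "norm (1 - \<alpha> ^ 2 / (4 * (s + of_nat n) ^ 2)) \<le> 1 + e n"
      using norm_triangle_ineq4[of 1 "\<alpha> ^ 2 / (4 * (s + of_nat n) ^ 2)"] that
      by (simp add: e_def norm_divide norm_mult norm_power)
         (smt (verit) divide_right_mono power_le_one norm_ge_zero zero_le_power)
    also have "\<dots> \<le> exp (e n)" by (rule exp_ge_add_one_self)
    finally have "norm (hyper_coeff (s - \<alpha> / 2) (s + \<alpha> / 2) (Suc n))
        \<le> exp (e n) * norm ((s + of_nat n) ^ 2 / of_nat (Suc n) ^ 2) * (exp (\<Sum>j<n. e j) * norm (hyper_coeff s s n))"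
      unfolding step norm_mult using Suc by (intro mult_mono) auto
    also have "\<dots> = exp (\<Sum>j<Suc n. e j) * norm (((s + of_nat n) ^ 2 / of_nat (Suc n) ^ 2) * hyper_coeff s s n)"
      by (simp only: norm_mult sum.lessThan_Suc exp_add mult_ac)
    also have "((s + of_nat n) ^ 2 / of_nat (Suc n) ^ 2) * hyper_coeff s s n = hyper_coeff s s (Suc n)"
      using hyper_coeff_symmetric_Suc[of s 0 n] by simp
    finally show ?case .
  qed (simp add: hyper_coeff_def)
  moreover have "exp (\<Sum>j<n. e j) \<le> exp (\<Sum>j. e j)" for n
    using summable_inverse_shifted_square[of s] by (auto simp: e_def intro!: sum_le_suminf)
  ultimately show ?thesis
    by (meson mult_right_mono norm_ge_zero order_trans)
qed

lemma hyper_coeff_symmetric_second_deriv: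
  assumes "s \<notin> \<int>\<^sub>\<le>\<^sub>0"
  shows "(deriv ^^ 2) (\<lambda>\<alpha>. hyper_coeff (s - \<alpha> / 2) (s + \<alpha> / 2) n) 0
    = - (1 / 2) * hyper_coeff s s n * (\<Sum>j<n. 1 / (s + of_nat j) ^ 2)"
proof (induction n)
  case 0
  show ?case by (simp add: hyper_coeff_def numeral_2_eq_2)
next
  case (Suc n)
  have "s + of_nat n \<noteq> 0"
    using assms by (metis add_eq_0_iff2 minus_of_nat_in_nonpos_Ints)
  moreover have "hyper_coeff s s (Suc n) = (s + of_nat n) ^ 2 / of_nat (Suc n) ^ 2 * hyper_coeff s s n"
    using hyper_coeff_symmetric_Suc[of s 0 n] by simp
  moreover have "(\<lambda>\<alpha>. hyper_coeff (s - \<alpha> / 2) (s + \<alpha> / 2) n) holomorphic_on UNIV"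
    unfolding hyper_coeff_def by (intro holomorphic_intros) auto
  from higher_deriv_2_even_quadratic_mult[OF this, of "(s + of_nat n) ^ 2 / of_nat (Suc n) ^ 2"
      "- 1 / (4 * of_nat (Suc n) ^ 2)"]
  have "(deriv ^^ 2) (\<lambda>\<alpha>. hyper_coeff (s - \<alpha> / 2) (s + \<alpha> / 2) (Suc n)) 0
      = (s + of_nat n) ^ 2 / of_nat (Suc n) ^ 2 *
          (- (1 / 2) * hyper_coeff s s n * (\<Sum>j<n. 1 / (s + of_nat j) ^ 2))
        + 2 * (- 1 / (4 * of_nat (Suc n) ^ 2)) * hyper_coeff s s n"
    unfolding hyper_coeff_symmetric_Suc Suc.IH by simp
  moreover have "w ^ 2 / m ^ 2 * (- (1 / 2) * h * S) + 2 * (- 1 / (4 * m ^ 2)) * h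
      = - (1 / 2) * (w ^ 2 / m ^ 2 * h) * (S + 1 / w ^ 2)" if "w \<noteq> 0" for w m h S :: complex
    using that by (simp add: distrib_left mult.assoc mult.commute[of 2])
  ultimately show ?case
    by (simp only: sum.lessThan_Suc)
qed

lemma higher_deriv_sum_entire:
  fixes f :: "nat \<Rightarrow> complex \<Rightarrow> complex"
  assumes "\<And>k. f k holomorphic_on UNIV"
  shows "(deriv ^^ m) (\<lambda>x. \<Sum>k<n. f k x) z = (\<Sum>k<n. (deriv ^^ m) (f k) z)"
proof (induction n)
  case 0
  show ?case by (cases "m = 0") (simp_all add: higher_deriv_const)
next
  case (Suc n)
  have "(\<lambda>x. \<Sum>k<n. f k x) holomorphic_on UNIV"
    by (intro holomorphic_intros assms)
  with Suc show ?case
    by (simp add: higher_deriv_add[of _ UNIV] assms)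
qed

text \<open>
  The Gauss series at \<open>- 1\<close> of \<open>hypK \<alpha> s\<close> converges uniformly for \<open>norm \<alpha> < 1\<close>, so by Weierstrass it may be
  differentiated termwise.
\<close>
lemma hypK2_term_sums:
  assumes s: "Re s < 1 / 2" "s \<notin> \<int>\<^sub>\<le>\<^sub>0"
  shows "(\<lambda>n. hypK2_term s (Suc n)) sums (- 2 * hypK2 s)"
proof -
  obtain C where C: "\<And>\<alpha> n. norm \<alpha> \<le> 1 \<Longrightarrow>
      norm (hyper_coeff (s - \<alpha> / 2) (s + \<alpha> / 2) n) \<le> C * norm (hyper_coeff s s n)"
    using hyper_coeff_symmetric_bound[OF s(2)] by blast
  have summable: "summable (\<lambda>n. C * norm (hyper_coeff s s n))"
    by (intro summable_mult summable_norm_hyper_coeff_diag s)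
  define t where "t = (\<lambda>n \<alpha>. (-1) ^ n * hyper_coeff (s - \<alpha> / 2) (s + \<alpha> / 2) n)"
  have t_holo: "t n holomorphic_on A" for n A
    unfolding t_def hyper_coeff_def by (intro holomorphic_intros) auto
  have "uniform_limit (ball 0 1) (\<lambda>N \<alpha>. \<Sum>n<N. t n \<alpha>) (\<lambda>\<alpha>. \<Sum>n. t n \<alpha>) sequentially"
    using C by (intro Weierstrass_m_test[OF _ summable]) (auto simp: t_def norm_mult norm_power)
  also have "?this \<longleftrightarrow> uniform_limit (ball 0 1) (\<lambda>N \<alpha>. \<Sum>n<N. t n \<alpha>) (\<lambda>\<alpha>. hypK \<alpha> s) sequentially"
  proof (rule uniform_limit_cong')
    fix \<alpha> :: complex assume "\<alpha> \<in> ball 0 1"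
    then have "summable (\<lambda>n. norm (hyper_coeff (s - \<alpha> / 2) (s + \<alpha> / 2) n))"
      using C by (intro summable_comparison_test'[OF summable]) auto
    then show "(\<Sum>n. t n \<alpha>) = hypK \<alpha> s"
      by (simp add: hypK_eq_series t_def)
  qed auto
  finally have "(\<lambda>N. (deriv ^^ 2) (\<lambda>\<alpha>. \<Sum>n<N. t n \<alpha>) 0) \<longlonglongrightarrow> hypK2 s"
    unfolding hypK2_def
    by (rule higher_deriv_complex_uniform_limit) (auto intro!: holomorphic_intros t_holo always_eventually)
  moreover have "(deriv ^^ 2) (\<lambda>\<alpha>. \<Sum>n<N. t n \<alpha>) 0 = - (1 / 2) * (\<Sum>n<N. hypK2_term s n)" for N
  proof -
    have "(deriv ^^ 2) (t n) 0 = - (1 / 2) * hypK2_term s n" for n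
    proof -
      have "(\<lambda>\<alpha>. hyper_coeff (s - \<alpha> / 2) (s + \<alpha> / 2) n) holomorphic_on UNIV"
        unfolding hyper_coeff_def by (intro holomorphic_intros) auto
      from higher_deriv_2_even_quadratic_mult[OF this, of "(-1) ^ n" 0]
      show ?thesis
        using hyper_coeff_symmetric_second_deriv[OF s(2), of n]
        by (simp add: t_def hypK2_term_def hyper_coeff_def power_divide power2_eq_square)
    qed
    moreover have "(deriv ^^ 2) (\<lambda>\<alpha>. \<Sum>n<N. t n \<alpha>) 0 = (\<Sum>n<N. (deriv ^^ 2) (t n) 0)"
      by (intro higher_deriv_sum_entire t_holo)
    ultimately show ?thesis by (simp add: sum_distrib_left)
  qed
  ultimately have "(\<lambda>N. - 2 * (- (1 / 2) * (\<Sum>n<N. hypK2_term s n))) \<longlonglongrightarrow> - 2 * hypK2 s"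
    by (intro tendsto_mult tendsto_const) simp
  then have "hypK2_term s sums (- 2 * hypK2 s)"
    by (simp add: sums_def)
  then show ?thesis
    by (subst sums_Suc_iff) (simp add: hypK2_term_def)
qed

section \<open>Kummer's evaluation of \<open>hypK0\<close>\<close>

text \<open>
  Kummer's summation for \<open>0 < s < 1 / 2\<close> by Euler's integral. Each \<open>(s)\<^sub>n / n!\<close> is, up to the constant
  \<open>Gamma s * Gamma (1 - s)\<close>, the \<open>n\<close>-th moment of the Beta weight
  \<open>w t = t powr (s - 1) * (1 - t) powr (- s)\<close> on the unit interval. Summing the binomial series under the
  integral gives \<open>t powr (s - 1) * (1 - t\<^sup>2) powr (- s)\<close>, which \<open>u = t\<^sup>2\<close> turns into a
  Beta integral again. The interchange is legitimate because the integrals of the absolute values are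
  multiples of the summable numbers \<open>((s)\<^sub>n / n!)\<^sup>2\<close>.
\<close>
lemma kummer_series_real:
  fixes s :: real
  assumes s: "0 < s" "s < 1 / 2"
  shows "(\<lambda>n. (-1) ^ n * (pochhammer s n / fact n) ^ 2) sums
           (Gamma (1 + s / 2) / (Gamma (1 + s) * Gamma (1 - s / 2)))"
proof -
  define c where "c = (\<lambda>n. pochhammer s n / fact n)"
  define w where "w = (\<lambda>t::real. indicator {0..1} t * (t powr (s - 1) * (1 - t) powr (- s)))"
  define f where "f = (\<lambda>n t. (- s gchoose n) * t ^ n * w t)"
  have c_nonneg: "c n \<ge> 0" for n
    using s by (simp add: c_def pochhammer_nonneg)
  have gchoose: "(- s gchoose n) = (-1) ^ n * c n" for n
    by (simp add: gbinomial_pochhammer c_def)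

  have moment: "has_bochner_integral lborel (\<lambda>t. t ^ n * w t) (c n * (Gamma s * Gamma (1 - s)))" for n
  proof -
    define h where "h = (\<lambda>t. t powr (s + real n - 1) * (1 - t) powr ((1 - s) - 1))"
    have h: "set_integrable lborel {0..1} h"
      unfolding h_def using s by (intro integrable_Beta) auto
    have "(LINT t:{0..1}|lborel. h t) = Beta (s + real n) (1 - s)"
      using has_integral_Beta_real[of "s + real n" "1 - s"] s set_borel_integral_eq_integral(2)[OF h]
      by (simp add: h_def integral_unique)
    also have "\<dots> = c n * (Gamma s * Gamma (1 - s))"
    proof -
      have "pochhammer s n = Gamma (s + real n) / Gamma s"
        using s by (intro pochhammer_Gamma) (auto elim!: nonpos_Ints_cases)
      then have "Gamma (s + real n) = pochhammer s n * Gamma s"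
        using s Gamma_real_pos[of s] by (simp add: less_imp_neq[symmetric])
      then show ?thesis
        by (simp add: Beta_def c_def Gamma_fact add.commute)
    qed
    finally have "has_bochner_integral lborel (\<lambda>t. indicator {0..1} t *\<^sub>R h t) (c n * (Gamma s * Gamma (1 - s)))"
      using h by (simp add: has_bochner_integral_iff set_integrable_def set_lebesgue_integral_def)
    also have "(\<lambda>t. indicator {0..1} t *\<^sub>R h t) = (\<lambda>t. t ^ n * w t)"
    proof
      fix t :: real
      show "indicator {0..1} t *\<^sub>R h t = t ^ n * w t"
      proof (cases "t > 0")
        case True
        then have "t powr (s + real n - 1) = t ^ n * t powr (s - 1)"
          by (simp add: powr_realpow[symmetric] flip: powr_add) (simp add: algebra_simps)
        then show ?thesis by (simp add: h_def w_def)
      next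
        case False
        then have "t = 0 \<or> t \<notin> {0..1}" by auto
        then show ?thesis by (auto simp: h_def w_def)
      qed
    qed
    finally show ?thesis .
  qed

  have f_integral: "has_bochner_integral lborel (f n) ((-1) ^ n * c n ^ 2 * (Gamma s * Gamma (1 - s)))" for n
    using has_bochner_integral_mult_right[OF moment[of n], of "- s gchoose n"]
    by (simp add: f_def gchoose power2_eq_square mult_ac)
  have norm_f: "norm (f n t) = c n * (t ^ n * w t)" for n t
    using c_nonneg[of n] by (auto simp: f_def gchoose abs_mult w_def power_abs indicator_def)
  have norm_f_integral: "(LINT t|lborel. norm (f n t)) = c n ^ 2 * (Gamma s * Gamma (1 - s))" for n
    using has_bochner_integral_integral_eq[OF has_bochner_integral_mult_right[OF moment[of n], of "c n"]]
    by (simp only: norm_f power2_eq_square mult.assoc)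
  have binomial: "(\<lambda>n. c n * t ^ n) sums (1 - t) powr (- s)" if "\<bar>t\<bar> < 1" for t
  proof -
    have "(- s gchoose n) * (- t) ^ n = c n * ((- 1) * (- t)) ^ n" for n
      unfolding gchoose power_mult_distrib by (simp only: mult_ac)
    then have "(- s gchoose n) * (- t) ^ n = c n * t ^ n" for n
      by simp
    then show ?thesis
      using gen_binomial_real[of "- t" "- s"] that by simp
  qed
  have "summable (\<lambda>n. norm (hyper_coeff (of_real s) (of_real s) n))"
    using s by (intro summable_norm_hyper_coeff_diag) auto
  moreover have "norm (hyper_coeff (of_real s) (of_real s) n) = c n ^ 2" for n
    using c_nonneg[of n]
    by (simp add: hyper_coeff_def pochhammer_of_real norm_divide norm_mult norm_power c_def power2_eq_square)
  ultimately have summable_c: "summable (\<lambda>n. c n ^ 2)"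
    by simp
  \<comment> \<open>since \<open>0 powr x = 0\<close>, the singular endpoint \<open>t = 1\<close> contributes \<open>0\<close> to every \<open>f n t\<close>, and summability holds for all \<open>t\<close>\<close>
  have w_1: "w 1 = 0" and w_outside: "t \<notin> {0..1} \<Longrightarrow> w t = 0" for t
    by (simp_all add: w_def)

  have "Gamma (1 + x) = x * Gamma x" if "x > 0" for x :: real
  proof -
    have "x \<notin> \<int>\<^sub>\<le>\<^sub>0" using that by (auto elim!: nonpos_Ints_cases)
    then show ?thesis using Gamma_plus1[of x] by (simp add: add.commute)
  qed
  then have Gamma_shift: "Gamma (1 + s / 2) = s / 2 * Gamma (s / 2)" "Gamma (1 + s) = s * Gamma s"
    using s by simp_all

  have "(\<lambda>n. LINT t|lborel. f n t) sums (LINT t|lborel. (\<Sum>n. f n t))"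
  proof (rule sums_integral)
    show "integrable lborel (f n)" for n
      using f_integral[of n] by (simp only: has_bochner_integral_iff)
    show "AE t in lborel. summable (\<lambda>n. norm (f n t))"
    proof (rule AE_I2)
      fix t :: real
      show "summable (\<lambda>n. norm (f n t))"
      proof (cases "t \<in> {0..<1}")
        case True
        then have "summable (\<lambda>n. c n * t ^ n * w t)"
          using binomial[of t] by (intro summable_mult2) (auto simp: sums_iff)
        then show ?thesis by (simp only: norm_f mult.assoc)
      next
        case False
        then have "t = 1 \<or> t \<notin> {0..1}" by auto
        then have "w t = 0" using w_1 w_outside by blast
        then show ?thesis by (simp only: norm_f) simp
      qed
    qed
    show "summable (\<lambda>n. LINT t|lborel. norm (f n t))"
      unfolding norm_f_integral by (intro summable_mult2 summable_c)
  qed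
  also have "(\<lambda>n. LINT t|lborel. f n t) = (\<lambda>n. (-1) ^ n * c n ^ 2 * (Gamma s * Gamma (1 - s)))"
    by (intro ext has_bochner_integral_integral_eq f_integral)
  also have "(LINT t|lborel. (\<Sum>n. f n t)) = Beta (s / 2) (1 - s) / 2"
  proof -
    define h where "h = (\<lambda>u::real. u powr (s / 2 - 1) * (1 - u) powr ((1 - s) - 1))"
    have h: "set_integrable lborel {0..1} h"
      unfolding h_def using s by (intro integrable_Beta) auto
    have "(\<Sum>n. f n t) = 1 / 2 * (h (t ^ 2) * (2 * t) * indicator {0..1} t)" for t
    proof (cases "t \<in> {0<..<1}")
      case True
      have "(\<lambda>n. f n t) sums ((1 + t) powr (- s) * w t)"
        unfolding f_def using gen_binomial_real[of t "- s"] True by (intro sums_mult2) auto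
      then have "(\<Sum>n. f n t) = (1 + t) powr (- s) * w t"
        by (simp add: sums_iff)
      also have "\<dots> = t powr (s - 1) * ((1 + t) powr (- s) * (1 - t) powr (- s))"
        using True by (simp add: w_def)
      also have "(1 + t) powr (- s) * (1 - t) powr (- s) = (1 - t ^ 2) powr (- s)"
      proof -
        have "(1 + t) * (1 - t) = 1 - t ^ 2"
          by (simp add: power2_eq_square algebra_simps)
        then show ?thesis
          using True powr_mult[of "1 + t" "1 - t" "- s"] by simp
      qed
      also have "t powr (s - 1) = (t ^ 2) powr (s / 2 - 1) * t"
      proof -
        have "(t ^ 2) powr (s / 2 - 1) * t = (t powr 2) powr (s / 2 - 1) * t powr 1"
          using True by simp
        also have "\<dots> = t powr (2 * (s / 2 - 1) + 1)"
          by (simp only: powr_powr powr_add)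
        also have "2 * (s / 2 - 1) + 1 = s - 1" by simp
        finally show ?thesis by simp
      qed
      finally show ?thesis
        using True by (simp add: h_def)
    next
      case False
      then have "t = 0 \<or> t = 1 \<or> t \<notin> {0..1}" by auto
      then show ?thesis
        using w_1 w_outside[of t] by (auto simp: f_def h_def w_def)
    qed
    then have "(LINT t|lborel. (\<Sum>n. f n t)) = 1 / 2 * (LBINT t. h (t ^ 2) * (2 * t) * indicator {0..1} t)"
      by (simp only: integral_mult_right_zero)
    also have "(LBINT t. h (t ^ 2) * (2 * t) * indicator {0..1} t) = (LBINT u. h u * indicator {0..1} u)"
    proof -
      have "(LBINT u. h u * indicator {0 ^ 2..1 ^ 2} u) = (LBINT t. h (t ^ 2) * (2 * t) * indicator {0..1} t)"
      proof (rule integral_substitution(2))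
        show "set_integrable lborel {0 ^ 2..1 ^ 2} h" using h by simp
      qed (auto intro!: derivative_eq_intros continuous_intros)
      then show ?thesis by simp
    qed
    also have "\<dots> = Beta (s / 2) (1 - s)"
      using has_integral_Beta_real[of "s / 2" "1 - s"] s set_borel_integral_eq_integral(2)[OF h]
      by (simp add: h_def integral_unique set_lebesgue_integral_def mult.commute)
    finally show ?thesis by simp
  qed
  finally have "(\<lambda>n. (-1) ^ n * c n ^ 2 * (Gamma s * Gamma (1 - s)) / (Gamma s * Gamma (1 - s)))
      sums (Beta (s / 2) (1 - s) / 2 / (Gamma s * Gamma (1 - s)))"
    by (rule sums_divide)
  moreover have "Gamma s > 0" "Gamma (1 - s) > 0" "Gamma (1 - s / 2) > 0" "Gamma (s / 2) > 0"
    using s by (auto intro!: Gamma_real_pos)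
  ultimately show ?thesis
    unfolding Gamma_shift using s by (simp add: c_def Beta_def mult_ac)
qed

text \<open>
  Both sides are entire in \<open>s\<close>, thanks to the formulation with \<open>rGamma\<close>, and agree on the real
  interval from \<open>0\<close> to \<open>1 / 2\<close>.
\<close>
lemma hypK0_rGamma:
  "hypK0 s * rGamma (1 + s / 2) = rGamma (1 + s) * rGamma (1 - s / 2)"
proof -
  define d where "d = (\<lambda>s. hypK0 s * rGamma (1 + s / 2) - rGamma (1 + s) * rGamma (1 - s / 2))"
  have "d s = 0"
  proof (rule analytic_continuation[of d UNIV "of_real ` {0<..<1/2}" "of_real (1 / 4)"])
    show "d holomorphic_on UNIV"
      unfolding d_def hypK0_def by (intro holomorphic_intros) auto
    show "complex_of_real (1 / 4) islimpt of_real ` {0<..<1/2}"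
      unfolding islimpt_approachable
    proof (intro allI impI)
      fix e :: real assume "e > 0"
      define x where "x = 1 / 4 + min (e / 2) (1 / 8 :: real)"
      have "x \<in> {0<..<1/2}" "x \<noteq> 1 / 4" "dist x (1 / 4) < e"
        using \<open>e > 0\<close> by (auto simp: x_def dist_real_def)
      then show "\<exists>z\<in>complex_of_real ` {0<..<1/2}. z \<noteq> of_real (1 / 4) \<and> dist z (of_real (1 / 4)) < e"
        by (intro bexI[of _ "of_real x"]) (auto simp only: dist_of_real of_real_eq_iff)
    qed
    fix z assume "z \<in> complex_of_real ` {0<..<1/2}"
    then obtain x where x: "z = of_real x" "0 < x" "x < 1 / 2" by auto
    have "summable (\<lambda>n. norm (hyper_coeff z z n))"
      using x by (intro summable_norm_hyper_coeff_diag) auto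
    then have "hypK0 z = (\<Sum>n. (-1) ^ n * hyper_coeff z z n)"
      using hypK_eq_series[of z 0] by (simp add: hypK0_def)
    also have "(\<lambda>n. (-1) ^ n * hyper_coeff z z n)
        = (\<lambda>n. of_real ((-1) ^ n * (pochhammer x n / fact n) ^ 2))"
      unfolding hyper_coeff_def x(1) pochhammer_of_real by (simp add: power2_eq_square)
    also have "(\<Sum>n. complex_of_real ((-1) ^ n * (pochhammer x n / fact n) ^ 2))
        = of_real (Gamma (1 + x / 2) / (Gamma (1 + x) * Gamma (1 - x / 2)))"
      by (rule sums_unique[OF sums_of_real[OF kummer_series_real[OF x(2,3)]], symmetric])
    finally have "hypK0 z = of_real (Gamma (1 + x / 2) * rGamma (1 + x) * rGamma (1 - x / 2))"
      by (simp only: rGamma_inverse_Gamma divide_inverse inverse_mult_distrib mult.assoc)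
    moreover have "rGamma (1 + z / 2) = of_real (rGamma (1 + x / 2))" "rGamma (1 + z) = of_real (rGamma (1 + x))"
      "rGamma (1 - z / 2) = of_real (rGamma (1 - x / 2))"
      by (simp_all add: x flip: rGamma_complex_of_real)
    moreover have "Gamma (1 + x / 2) > 0"
      using x by (intro Gamma_real_pos) auto
    then have "Gamma (1 + x / 2) * rGamma (1 + x / 2) = 1"
      unfolding rGamma_inverse_Gamma by (intro right_inverse) linarith
    then have "Gamma (1 + x / 2) * rGamma (1 + x) * rGamma (1 - x / 2) * rGamma (1 + x / 2)
        = rGamma (1 + x) * rGamma (1 - x / 2)"
      by algebra
    ultimately show "d z = 0"
      unfolding d_def by (simp only: right_minus_eq flip: of_real_mult)
  qed auto
  then show ?thesis by (simp add: d_def)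
qed

lemma not_Int_rGamma_nonzero:
  assumes "s \<notin> \<int>"
  shows "rGamma (1 + s / 2) \<noteq> 0" "rGamma (1 - s / 2) \<noteq> 0" "rGamma (1 + s) \<noteq> (0 :: complex)"
proof -
  \<comment> \<open>\<open>k\<close> covers the arguments \<open>1 + s / 2\<close> and \<open>1 - s / 2\<close> together\<close>
  have not_Int: "of_int m + of_int k * s / 2 \<noteq> of_int n" if "k \<in> {1, -1}" for m k n :: int
  proof
    assume "of_int m + of_int k * s / 2 = of_int n"
    then have "s = of_int (2 * k * (n - m))"
      using that by (auto simp: field_simps)
    with assms show False using Ints_of_int by metis
  qed
  show "rGamma (1 + s / 2) \<noteq> 0" "rGamma (1 - s / 2) \<noteq> 0"
    using not_Int[of 1 1] not_Int[of "-1" 1]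
    by (auto simp: rGamma_eq_zero_iff elim!: nonpos_Ints_cases)
  show "rGamma (1 + s) \<noteq> 0"
    using assms Ints_diff[of "1 + s" 1] nonpos_Ints_Int[of "1 + s"]
    by (auto simp: rGamma_eq_zero_iff)
qed

lemma hypK0_eq_Gamma:
  assumes "s \<notin> \<int>"
  shows "hypK0 s = Gamma (1 + s / 2) / (Gamma (1 + s) * Gamma (1 - s / 2))"
  using hypK0_rGamma[of s] not_Int_rGamma_nonzero[OF assms]
  by (simp add: Gamma_def field_simps)

lemma hypK0_nonzero:
  assumes "s \<notin> \<int>"
  shows "hypK0 s \<noteq> 0"
  using hypK0_rGamma[of s] not_Int_rGamma_nonzero[OF assms] by auto

lemma ratio_r_eq_Gamma:
  assumes "s \<notin> \<int>"
  shows "ratio_r s = 2 * Gamma (1 + s / 2) * Gamma ((1 - s) / 2) /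
                      (Gamma (1 - s / 2) * Gamma ((1 + s) / 2))"
proof -
  have s1: "s + 1 \<notin> \<int>"
    using assms Ints_diff[of "s + 1" 1] by auto
  have shift: "1 + (s + 1) / 2 = (1 + s) / 2 + 1" "1 + (s + 1) = 1 + s + 1" "1 - (s + 1) / 2 = (1 - s) / 2"
    by (simp_all add: field_simps)
  have "hypK0 (s + 1) = Gamma ((1 + s) / 2 + 1) / (Gamma (1 + s + 1) * Gamma ((1 - s) / 2))"
    using hypK0_eq_Gamma[OF s1] unfolding shift .
  also have "Gamma ((1 + s) / 2 + 1) = (1 + s) / 2 * Gamma ((1 + s) / 2)"
  proof (rule Gamma_plus1)
    show "(1 + s) / 2 \<notin> \<int>\<^sub>\<le>\<^sub>0"
    proof
      assume "(1 + s) / 2 \<in> \<int>\<^sub>\<le>\<^sub>0"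
      then have "2 * ((1 + s) / 2) - 1 \<in> \<int>"
        by (intro Ints_diff Ints_mult) (auto intro: nonpos_Ints_Int)
      moreover have "2 * ((1 + s) / 2) - 1 = s" by (simp add: field_simps)
      ultimately have "s \<in> \<int>" by (simp only:)
      with assms show False ..
    qed
  qed
  also have "Gamma (1 + s + 1) = (1 + s) * Gamma (1 + s)"
    using not_Int_rGamma_nonzero(3)[OF assms] by (intro Gamma_plus1) (simp add: rGamma_eq_zero_iff)
  finally have denominator: "hypK0 (s + 1)
      = ((1 + s) / 2 * Gamma ((1 + s) / 2)) / ((1 + s) * Gamma (1 + s) * Gamma ((1 - s) / 2))" .
  have "1 + s \<noteq> 0"
  proof
    assume "1 + s = 0"
    then have "s = - 1" by (simp add: add_eq_0_iff)
    with assms show False by simp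
  qed
  moreover have "Gamma (1 + s) \<noteq> 0"
    using not_Int_rGamma_nonzero(3)[OF assms] by (simp add: Gamma_def)
  ultimately show ?thesis
    unfolding ratio_r_def denominator hypK0_eq_Gamma[OF assms] by (simp add: divide_simps)
qed

section \<open>The quotients on the non-integers\<close>

lemma hypK0_two_step:
  assumes "s \<notin> \<int>"
  shows "hypK0 (s - 1) = - (4 * s / (s - 1)) * hypK0 (s + 1)"
proof -
  have "s \<noteq> 0" "s - 1 \<noteq> 0" using assms by auto
  then have "4 * s * hypK0 (s + 1) + (s - 1) * hypK0 (s - 1) = 0"
    using hypK0_recurrence[of s] by simp
  then have "(s - 1) * hypK0 (s - 1) = - (4 * s * hypK0 (s + 1))"
    by (simp add: eq_neg_iff_add_eq_0 add.commute)
  then have "hypK0 (s - 1) = - (4 * s * hypK0 (s + 1)) / (s - 1)"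
    using \<open>s - 1 \<noteq> 0\<close> by (metis nonzero_mult_div_cancel_left)
  then show ?thesis by simp
qed

lemma not_Int_shift:
  assumes "(s :: complex) \<notin> \<int>"
  shows "s - 1 \<notin> \<int>" "s + 1 \<notin> \<int>"
  using assms Ints_add[of "s - 1" 1] Ints_diff[of "s + 1" 1] by auto

text \<open>
  Divide the recurrence for \<open>hypK2\<close> by \<open>8 * s ^ 2 * (s - 1) * hypK0 (s + 1)\<close>, after expressing \<open>hypK0 (s - 1)\<close> by
  \<open>hypK0 (s + 1)\<close>. The term in \<open>hypK0 (s + 1)\<close> simplifies by \<open>(s - 1)\<^sup>2 - s\<^sup>2 = - (2 * s - 1)\<close>.
\<close>
lemma quotQ_recurrence:
  assumes "s \<notin> \<int>"
  shows "quotQ (s + 1) - quotQ (s - 1) = inhom_f s"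
proof -
  define A B x y where "A = hypK0 (s + 1)" and "B = hypK0 s" and "x = hypK2 (s + 1)" and "y = hypK2 (s - 1)"
  have nz: "A \<noteq> 0" "s \<noteq> 0" "s - 1 \<noteq> 0"
    using assms not_Int_shift(2)[OF assms] hypK0_nonzero[of "s + 1"] by (auto simp: A_def)
  have C: "hypK0 (s - 1) = - (4 * s / (s - 1)) * A"
    unfolding A_def by (rule hypK0_two_step[OF assms])
  have rec: "8 * s ^ 2 * (s - 1) * x + 2 * s * (s - 1) ^ 2 * y
      = 4 * (s - 1) * A - 2 * (2 * s - 1) * B + s * (- (4 * s / (s - 1)) * A)"
    using hypK2_recurrence[of s] unfolding A_def[symmetric] B_def[symmetric] x_def[symmetric] y_def[symmetric] C .
  have "quotQ (s + 1) - quotQ (s - 1) = x / A - y / (- (4 * s / (s - 1)) * A)"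
    by (simp only: quotQ_def x_def y_def A_def C)
  also have "\<dots> = (8 * s ^ 2 * (s - 1) * x + 2 * s * (s - 1) ^ 2 * y) / (8 * s ^ 2 * (s - 1) * A)"
  proof -
    define t where "t = s - 1"
    have t: "t \<noteq> 0" using nz by (simp add: t_def)
    have "8 * s ^ 2 * t * x / (8 * s ^ 2 * t * A) = x / A"
      using t nz(2) by simp
    moreover have "2 * s * t ^ 2 * y / (8 * s ^ 2 * t * A) = y * t / (4 * s * A)"
      using t nz(2) by (simp add: power2_eq_square mult_ac)
    moreover have "y / (- (4 * s / t) * A) = - (y * t / (4 * s * A))"
      by simp
    ultimately show ?thesis
      unfolding t_def[symmetric] by (simp only: add_divide_distrib diff_minus_eq_add)
  qed
  also have "\<dots> = - (2 * s - 1) / (2 * s ^ 2 * (s - 1) ^ 2) - (2 * s - 1) * (B / A) / (4 * s ^ 2 * (s - 1))"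
  proof -
    define t where "t = s - 1"
    have t: "t \<noteq> 0" "s = t + 1" using nz by (auto simp: t_def)
    have "4 * t * A - 2 * (2 * s - 1) * B + s * (- (4 * s / t) * A)
        = - (4 * (2 * s - 1) * A / t) - 2 * (2 * s - 1) * B"
      unfolding t(2) using t(1) by (simp add: field_simps)
    moreover have "- (4 * u * A / t) / (8 * s ^ 2 * t * A) = - u / (2 * s ^ 2 * t ^ 2)" for u
      using nz(1) by (simp add: power2_eq_square mult_ac)
    moreover have "2 * u * B / (8 * s ^ 2 * t * A) = u * (B / A) / (4 * s ^ 2 * t)" for u
      by (simp add: mult_ac)
    ultimately show ?thesis
      unfolding rec unfolding t_def[symmetric] by (simp only: diff_divide_distrib)
  qed
  finally show ?thesis by (simp add: inhom_f_def ratio_r_def A_def B_def)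
qed

lemma ratio_r_two_step:
  assumes "s \<notin> \<int>"
  shows "ratio_r (s - 2) = ratio_r s * ((s - 1) ^ 2 / (s * (s - 2)))"
proof -
  have "hypK0 (s - 2) = - (4 * (s - 1) / (s - 2)) * hypK0 s"
    using hypK0_two_step[OF not_Int_shift(1)[OF assms]] by simp
  moreover have "s - 2 + 1 = s - 1" by simp
  moreover have "(- (4 * u / v) * B) / (- (4 * s / u) * A) = B / A * (u ^ 2 / (s * v))" for u v A B
    by (simp add: power2_eq_square mult_ac)
  ultimately show ?thesis
    unfolding ratio_r_def by (simp only: hypK0_two_step[OF assms])
qed

section \<open>Summation along a lattice\<close>

lemma lattice_from_cases:
  assumes "\<sigma> \<in> lattice_from s\<^sub>0" "s\<^sub>0 < 0"
  obtains y where "y > 0" "\<sigma> = - complex_of_real y"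
proof -
  from assms obtain k where "\<sigma> = complex_of_real s\<^sub>0 - 2 * of_nat k"
    by (auto simp: lattice_from_def)
  then show ?thesis
    using assms(2) by (intro that[of "2 * real k - s\<^sub>0"]) auto
qed

lemma not_Int_lattice_from:
  assumes "s\<^sub>0 \<notin> \<int>"
  shows "complex_of_real s\<^sub>0 - 2 * of_nat k \<notin> \<int>"
proof
  assume "complex_of_real s\<^sub>0 - 2 * of_nat k \<in> \<int>"
  then have "complex_of_real s\<^sub>0 - 2 * of_nat k + 2 * of_nat k \<in> \<int>"
    by (rule Ints_add) (auto intro: Ints_mult)
  then show False
    using assms by simp
qed

text \<open>
  With \<open>\<sigma> = - y\<close>, one step to the left multiplies \<open>ratio_r\<close> by
  \<open>(y + 1)\<^sup>2 / (y * (y + 2)) > 1\<close>. The infinite product of these factors converges, and an explicit weight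
  shows it: the norm of \<open>ratio_r\<close> times \<open>(y + 1) / y\<close> decreases, because
  \<open>(y + 1) * (y + 3) \<le> (y + 2)\<^sup>2\<close>, while the weight stays above \<open>1\<close>.
\<close>
lemma ratio_r_bounded_on_lattice:
  assumes "s\<^sub>0 < 0" "s\<^sub>0 \<notin> \<int>"
  shows "\<exists>R. \<forall>\<sigma>\<in>lattice_from s\<^sub>0. norm (ratio_r \<sigma>) \<le> R"
proof -
  define y where "y = (\<lambda>k::nat. 2 * real k - s\<^sub>0)"
  define q where "q = (\<lambda>k::nat. norm (ratio_r (complex_of_real s\<^sub>0 - 2 * of_nat k)))"
  define M where "M = q 0 * ((y 0 + 1) / y 0)"
  have y_pos: "y k > 0" for k
    using assms by (simp add: y_def add_nonneg_pos)
  have M: "q k * ((y k + 1) / y k) \<le> M" for k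
  proof (induction k)
    case (Suc k)
    let ?s = "complex_of_real s\<^sub>0 - 2 * of_nat k"
    let ?y = "y k"
    have s: "?s = - of_real ?y" by (simp add: y_def)
    have "complex_of_real s\<^sub>0 - 2 * of_nat (Suc k) = ?s - 2" by simp
    then have "q (Suc k) = norm (ratio_r ?s * ((?s - 1) ^ 2 / (?s * (?s - 2))))"
      unfolding q_def by (simp only: ratio_r_two_step[OF not_Int_lattice_from[OF assms(2)]])
    also have "(?s - 1) ^ 2 / (?s * (?s - 2)) = of_real ((?y + 1) ^ 2 / (?y * (?y + 2)))"
    proof -
      have "(?s - 1) ^ 2 = of_real ((?y + 1) ^ 2)" "?s * (?s - 2) = of_real (?y * (?y + 2))"
        unfolding s by (simp_all add: power2_eq_square algebra_simps)
      then show ?thesis by (simp only: of_real_divide)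
    qed
    also have "norm (ratio_r ?s * of_real ((?y + 1) ^ 2 / (?y * (?y + 2)))) = q k * ((?y + 1) ^ 2 / (?y * (?y + 2)))"
      using y_pos[of k] by (simp only: norm_mult q_def norm_of_real abs_of_nonneg) simp
    finally have q_Suc: "q (Suc k) = q k * ((?y + 1) ^ 2 / (?y * (?y + 2)))" .
    have y_Suc: "y (Suc k) + 1 = ?y + 3" "y (Suc k) = ?y + 2" by (simp_all add: y_def)
    have "q (Suc k) * ((y (Suc k) + 1) / y (Suc k))
        = q k * ((?y + 1) / ?y) * ((?y + 1) * (?y + 3) / (?y + 2) ^ 2)"
      unfolding q_Suc unfolding y_Suc(1) unfolding y_Suc(2)
      by (simp only: times_divide_eq_right times_divide_eq_left divide_divide_eq_left power2_eq_square mult_ac)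
    also have "\<dots> \<le> q k * ((?y + 1) / ?y) * 1"
    proof (intro mult_left_mono)
      have "(?y + 1) * (?y + 3) \<le> (?y + 2) ^ 2"
        by (simp add: power2_eq_square algebra_simps)
      then show "(?y + 1) * (?y + 3) / (?y + 2) ^ 2 \<le> 1"
        using y_pos[of k] by (subst divide_le_eq_1_pos) auto
      show "0 \<le> q k * ((?y + 1) / ?y)"
        using y_pos[of k] by (simp add: q_def)
    qed
    also have "\<dots> \<le> M" using Suc by simp
    finally show ?case .
  qed (simp add: M_def)
  have "q k \<le> M" for k
  proof -
    have "q k * 1 \<le> q k * ((y k + 1) / y k)"
      using y_pos[of k] by (intro mult_left_mono) (auto simp: q_def)
    with M[of k] show ?thesis by linarith
  qed
  then show ?thesis
    by (auto simp: lattice_from_def q_def)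
qed

lemma inhom_f_bound_on_lattice:
  assumes "s\<^sub>0 < 0" "s\<^sub>0 \<notin> \<int>"
  shows "\<exists>C>0. \<forall>\<sigma>\<in>lattice_from s\<^sub>0. norm (inhom_f \<sigma>) \<le> C * norm (1 / \<sigma> ^ 2)"
proof -
  obtain R where R: "\<And>\<sigma>. \<sigma> \<in> lattice_from s\<^sub>0 \<Longrightarrow> norm (ratio_r \<sigma>) \<le> R"
    using ratio_r_bounded_on_lattice[OF assms] by blast
  have "complex_of_real s\<^sub>0 \<in> lattice_from s\<^sub>0"
    by (auto simp: lattice_from_def intro!: exI[of _ 0])
  then have "R \<ge> 0"
    using R norm_ge_zero order_trans by blast
  have "norm (inhom_f \<sigma>) \<le> (1 + R) * norm (1 / \<sigma> ^ 2)" if \<sigma>: "\<sigma> \<in> lattice_from s\<^sub>0" for \<sigma>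
  proof -
    obtain y where y: "y > 0" "\<sigma> = - complex_of_real y"
      using \<sigma> assms(1) by (rule lattice_from_cases)
    have norms: "norm (2 * \<sigma> - 1) = 2 * y + 1" "norm (\<sigma> - 1) = y + 1" "norm \<sigma> = y"
    proof -
      have "2 * \<sigma> - 1 = of_real (- (2 * y + 1))" "\<sigma> - 1 = of_real (- (y + 1))" "\<sigma> = of_real (- y)"
        by (simp_all add: y)
      then show "norm (2 * \<sigma> - 1) = 2 * y + 1" "norm (\<sigma> - 1) = y + 1" "norm \<sigma> = y"
        using y(1) by (simp_all only: norm_of_real)
    qed
    have "norm (inhom_f \<sigma>) \<le> norm (- (2 * \<sigma> - 1) / (2 * \<sigma> ^ 2 * (\<sigma> - 1) ^ 2))
        + norm ((2 * \<sigma> - 1) * ratio_r \<sigma> / (4 * \<sigma> ^ 2 * (\<sigma> - 1)))"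
      unfolding inhom_f_def by (rule norm_triangle_ineq4)
    also have "\<dots> = (2 * y + 1) / (2 * y ^ 2 * (y + 1) ^ 2) + (2 * y + 1) * norm (ratio_r \<sigma>) / (4 * y ^ 2 * (y + 1))"
      by (simp only: norm_divide norm_mult norm_power norm_minus_cancel norms norm_numeral)
    also have "\<dots> = ((2 * y + 1) / (2 * (y + 1) ^ 2) + (2 * y + 1) / (4 * (y + 1)) * norm (ratio_r \<sigma>)) * (1 / y ^ 2)"
    proof -
      have "u / (2 * y ^ 2 * v ^ 2) + u * \<rho> / (4 * y ^ 2 * v) = (u / (2 * v ^ 2) + u / (4 * v) * \<rho>) * (1 / y ^ 2)"
        for u v \<rho> :: real
        by (simp add: add_divide_distrib mult_ac)
      then show ?thesis .
    qed
    also have "\<dots> \<le> (1 + 1 * R) * (1 / y ^ 2)"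
    proof (intro mult_right_mono add_mono mult_mono)
      have "2 * y + 1 \<le> 2 * (y + 1) ^ 2"
        using y(1) by (simp add: power2_eq_square algebra_simps)
      then show "(2 * y + 1) / (2 * (y + 1) ^ 2) \<le> 1"
        using y(1) by (subst divide_le_eq_1_pos) auto
      show "(2 * y + 1) / (4 * (y + 1)) \<le> 1"
        using y(1) by simp
    qed (use R[OF \<sigma>] in auto)
    also have "1 / y ^ 2 = norm (1 / \<sigma> ^ 2)"
      by (simp add: norm_divide norm_power norms)
    finally show ?thesis by simp
  qed
  then show ?thesis
    using \<open>R \<ge> 0\<close> by (intro exI[of _ "1 + R"]) auto
qed

text \<open>
  The arguments \<open>s - 1 - 2 * k\<close> belong to the neighbouring lattice that starts at \<open>s\<^sub>0 - 1\<close>, so the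
  quadratic decay is applied there.
\<close>
lemma summable_inhom_f_lattice:
  assumes s\<^sub>0: "s\<^sub>0 < 0" "s\<^sub>0 \<notin> \<int>" and s: "s \<in> lattice_from s\<^sub>0"
  shows "summable (\<lambda>k. norm (inhom_f (s - 1 - 2 * of_nat k)))"
proof -
  have "s\<^sub>0 - 1 < 0" "s\<^sub>0 - 1 \<notin> \<int>"
    using s\<^sub>0 Ints_add[of "s\<^sub>0 - 1" 1] by auto
  then obtain C where C: "C > 0" "\<And>\<sigma>. \<sigma> \<in> lattice_from (s\<^sub>0 - 1) \<Longrightarrow> norm (inhom_f \<sigma>) \<le> C * norm (1 / \<sigma> ^ 2)"
    using inhom_f_bound_on_lattice[of "s\<^sub>0 - 1"] by blast
  show ?thesis
  proof (rule summable_comparison_test')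
    have "summable (\<lambda>k. inverse (real (Suc k) ^ 2))"
      using inverse_power_summable[of 2, where ?'a = real] summable_Suc_iff[of "\<lambda>k. inverse (real k ^ 2)"] by simp
    then show "summable (\<lambda>k. C * inverse (real (Suc k) ^ 2))"
      by (rule summable_mult)
    fix k :: nat
    have mem: "s - 1 - 2 * of_nat k \<in> lattice_from (s\<^sub>0 - 1)"
    proof -
      obtain m where "s = complex_of_real s\<^sub>0 - 2 * of_nat m"
        using s by (auto simp: lattice_from_def)
      then show ?thesis
        by (auto simp: lattice_from_def algebra_simps intro!: exI[of _ "m + k"])
    qed
    obtain y where y: "y > 0" "s = - complex_of_real y"
      using s s\<^sub>0(1) by (rule lattice_from_cases)
    have "s - 1 - 2 * of_nat k = of_real (- (y + 1 + 2 * real k))"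
      by (simp add: y)
    moreover have "norm (complex_of_real (- (y + 1 + 2 * real k))) = y + 1 + 2 * real k"
      using y(1) unfolding norm_of_real by simp
    ultimately have "norm (s - 1 - 2 * of_nat k) = y + 1 + 2 * real k"
      by (simp only:)
    then have "real (Suc k) \<le> norm (s - 1 - 2 * of_nat k)"
      using y(1) by simp
    then have "inverse (norm (s - 1 - 2 * of_nat k) ^ 2) \<le> inverse (real (Suc k) ^ 2)"
      by (intro le_imp_inverse_le power_mono) auto
    then have "norm (1 / (s - 1 - 2 * of_nat k) ^ 2) \<le> inverse (real (Suc k) ^ 2)"
      by (simp add: norm_divide norm_power inverse_eq_divide del: of_nat_Suc)
    then have "C * norm (1 / (s - 1 - 2 * of_nat k) ^ 2) \<le> C * inverse (real (Suc k) ^ 2)"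
      using C(1) by (intro mult_left_mono) auto
    then show "norm (norm (inhom_f (s - 1 - 2 * of_nat k))) \<le> C * inverse (real (Suc k) ^ 2)"
      using C(2)[OF mem] by simp
  qed
qed

text \<open>
  Telescoping \<open>quotQ s - quotQ (s - 2) = inhom_f (s - 1)\<close> from \<open>s\<^sub>0\<close> down to \<open>s\<close> leaves a tail of the
  convergent series. The constant \<open>c\<close> is \<open>quotQ s\<^sub>0\<close> minus the whole sum, in effect the limit of
  \<open>quotQ\<close> at the far end of the lattice.
\<close>
lemma hypK2_lattice_expansion:
  assumes s\<^sub>0: "s\<^sub>0 < 0" "s\<^sub>0 \<notin> \<int>"
  shows "\<exists>c. \<forall>s\<in>lattice_from s\<^sub>0.
    hypK2 s = hypK0 s * (c + (\<Sum>k. inhom_f (s - 1 - 2 * of_nat k)))"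
proof -
  define z where "z = (\<lambda>m::nat. complex_of_real s\<^sub>0 - 2 * of_nat m)"
  define F where "F = (\<lambda>k::nat. inhom_f (complex_of_real s\<^sub>0 - 1 - 2 * of_nat k))"
  have "complex_of_real s\<^sub>0 \<in> lattice_from s\<^sub>0"
    by (auto simp: lattice_from_def intro!: exI[of _ 0])
  then have F: "summable F"
    unfolding F_def by (rule summable_norm_cancel[OF summable_inhom_f_lattice[OF s\<^sub>0]])
  have not_Int: "z m \<notin> \<int>" for m
    unfolding z_def by (rule not_Int_lattice_from[OF s\<^sub>0(2)])
  have Q: "quotQ (z m) = quotQ (z 0) - (\<Sum>k<m. F k)" for m
  proof (induction m)
    case (Suc m)
    have "quotQ (z m - 1 + 1) - quotQ (z m - 1 - 1) = inhom_f (z m - 1)"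
      by (intro quotQ_recurrence not_Int_shift not_Int)
    moreover have "z m - 1 - 1 = z (Suc m)" "inhom_f (z m - 1) = F m"
      by (simp_all add: z_def F_def algebra_simps)
    ultimately show ?case
      using Suc by (simp add: algebra_simps)
  qed simp
  have "hypK2 s = hypK0 s * (quotQ (z 0) - suminf F + (\<Sum>k. inhom_f (s - 1 - 2 * of_nat k)))"
    if "s \<in> lattice_from s\<^sub>0" for s
  proof -
    obtain m where m: "s = z m"
      using \<open>s \<in> lattice_from s\<^sub>0\<close> by (auto simp: lattice_from_def z_def)
    have "inhom_f (s - 1 - 2 * of_nat k) = F (k + m)" for k
      by (simp add: m z_def F_def algebra_simps)
    then have "quotQ (z 0) - suminf F + (\<Sum>k. inhom_f (s - 1 - 2 * of_nat k)) = quotQ (z 0) - (\<Sum>k<m. F k)"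
      using suminf_split_initial_segment[OF F, of m] by simp
    also have "\<dots> = quotQ s"
      unfolding m by (rule Q[symmetric])
    finally show ?thesis
      using hypK0_nonzero[OF not_Int[of m]] by (simp add: quotQ_def m)
  qed
  then show ?thesis by blast
qed

theorem theorem7p9:
  shows
    "(\<forall>s::complex. Re s < 1/2 \<and> s \<notin> \<int>\<^sub>\<le>\<^sub>0 \<longrightarrow>
        summable (\<lambda>n. hypK2_term s (Suc n)) \<and>
        hypK2 s = - (1/2) * (\<Sum>n. hypK2_term s (Suc n)))
   \<and> (\<forall>s::complex.
        8 * s ^ 2 * (s - 1) * hypK2 (s + 1) + 2 * s * (s - 1) ^ 2 * hypK2 (s - 1)
          = 4 * (s - 1) * hypK0 (s + 1) - 2 * (2 * s - 1) * hypK0 s + s * hypK0 (s - 1))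
   \<and> (\<forall>s::complex. s \<notin> \<int> \<longrightarrow>
        hypK0 s \<noteq> 0 \<and>
        quotQ (s + 1) - quotQ (s - 1) = inhom_f s \<and>
        ratio_r s = 2 * Gamma (1 + s / 2) * Gamma ((1 - s) / 2) /
                      (Gamma (1 - s / 2) * Gamma ((1 + s) / 2)))
   \<and> (\<forall>s\<^sub>0::real. s\<^sub>0 < 0 \<and> 2 * s\<^sub>0 \<notin> \<int>\<^sub>\<le>\<^sub>0 \<longrightarrow>
        bounded (ratio_r ` lattice_from s\<^sub>0) \<and>
        inhom_f \<in> O[principal (lattice_from s\<^sub>0)](\<lambda>\<sigma>. 1 / \<sigma> ^ 2) \<and>
        (\<forall>s\<in>lattice_from s\<^sub>0. summable (\<lambda>k. norm (inhom_f (s - 1 - 2 * of_nat k)))) \<and>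
        (\<exists>c. \<forall>s\<in>lattice_from s\<^sub>0.
           hypK2 s = hypK0 s * (c + (\<Sum>k. inhom_f (s - 1 - 2 * of_nat k)))))"
proof (intro conjI allI impI ballI)
  fix s :: complex assume "Re s < 1 / 2 \<and> s \<notin> \<int>\<^sub>\<le>\<^sub>0"
  then have "(\<lambda>n. hypK2_term s (Suc n)) sums (- 2 * hypK2 s)"
    using hypK2_term_sums by blast
  then show "summable (\<lambda>n. hypK2_term s (Suc n))" "hypK2 s = - (1/2) * (\<Sum>n. hypK2_term s (Suc n))"
    by (simp_all add: sums_iff)
next
  fix s\<^sub>0 :: real assume s\<^sub>0: "s\<^sub>0 < 0 \<and> 2 * s\<^sub>0 \<notin> \<int>\<^sub>\<le>\<^sub>0"
  have "s\<^sub>0 \<notin> \<int>"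
  proof
    assume "s\<^sub>0 \<in> \<int>"
    then have "2 * s\<^sub>0 \<in> \<int>" by simp
    then show False using s\<^sub>0 by (auto simp: nonpos_Ints_altdef)
  qed
  with s\<^sub>0 have lattice: "s\<^sub>0 < 0" "s\<^sub>0 \<notin> \<int>" by auto
  show "bounded (ratio_r ` lattice_from s\<^sub>0)"
    using ratio_r_bounded_on_lattice[OF lattice] by (auto simp: bounded_iff)
  show "inhom_f \<in> O[principal (lattice_from s\<^sub>0)](\<lambda>\<sigma>. 1 / \<sigma> ^ 2)"
    using inhom_f_bound_on_lattice[OF lattice] by (auto simp: bigo_def eventually_principal)
  show "summable (\<lambda>k. norm (inhom_f (s - 1 - 2 * of_nat k)))" if "s \<in> lattice_from s\<^sub>0" for s
    using lattice that by (rule summable_inhom_f_lattice)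
  show "\<exists>c. \<forall>s\<in>lattice_from s\<^sub>0.
      hypK2 s = hypK0 s * (c + (\<Sum>k. inhom_f (s - 1 - 2 * of_nat k)))"
    using lattice by (rule hypK2_lattice_expansion)
qed (auto simp: hypK2_recurrence hypK0_nonzero quotQ_recurrence ratio_r_eq_Gamma)

end
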